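(* For any $\epsilon,\delta>0$ and any distribution $\mathcal{D}$ over component maintenance games with $n$ agents (with repair costs at most $H$), $O\!\left(\frac{n^2H^2}{\epsilon^2}\left(n^2+\log\frac1\delta\right)\right)$ games drawn i.i.d. from $\mathcal{D}$ suffice to ensure that, with probability at least $1-\delta$ over the draw, the subsidy vector $\hat\sigma\in[0,H]^n$ minimizing the average loss $L_{\mathrm{prior}}$ over the sample has expected loss $\mathbb{E}_{G\sim\mathcal{D}}[L^G_{\mathrm{prior}}(\hat\sigma)]$ at most $\epsilon$ larger than that of the best subsidy vector over $\mathcal{D}$, $\min_{\sigma\in[0,H]^n}\mathbb{E}_{G\sim\mathcal{D}}[L^G_{\mathrm{prior}}(\sigma)]$.
   Context: Component maintenance game with $n$ agents: agent $i$ owns component $i$ with random state $x_i\in\{0,1\}$ under a common prior $\theta$ (independent components), Boolean system function $\phi$, repair costs $C_i\le H$. Agent $i$ chooses $s_i\in\{0,1\}$ (1 = repair); post-action state $x_i'=\max\{x_i,s_i\}$; expected cost $l_i(s)=C_is_i+1-\mathbb{E}_\theta[\phi(\bm{x}'(s))]$. A (non-uniform) subsidy scheme is a vector $\sigma=(\sigma_1,\dots,\sigma_n)\in[0,H]^n$: agent $i$ receives $\mathrm{subs}_i(s)=\sigma_is_i$, with subsidized cost $l_i(s)-\mathrm{subs}_i(s)$, $\mathrm{cost}^\sigma(s)=\sum_i(l_i(s)-\mathrm{subs}_i(s))$ and $\mathrm{subs}(s)=\sum_i\mathrm{subs}_i(s)$. With $\mathcal{S}_{NE}(\sigma)$ the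 pure Nash equilibria of the subsidized game, the loss of game $G$ is $L^G_{\mathrm{prior}}(\sigma)=\max_{s\in\mathcal{S}_{NE}(\sigma)}\mathrm{cost}^\sigma(s)+\mathrm{subs}(s)$ (at most $(2H+1)n$).
   Formalization: The bound is proved for H ≥ 1: as stated for all H > 0 it fails when H is small, because the loss range (2H+1)n does not shrink with H while the sample bound n²H²/ε²(n²+log 1/δ) tends to zero. *)

theory Defs
  imports "HOL-Probability.Probability"
begin

text \<open>A component maintenance game with agents/components indexed by 0..n-1.
  The prior over component states is a product (independent components):
  component i works (x_i = 1) with probability prior G i.
  States and strategy profiles are Boolean vectors nat => bool that are False outside {0..<n}.\<close>

record cm_game =
  rcost  :: "nat \<Rightarrow> real"
  prior  :: "nat \<Rightarrow> real"                 \<comment> \<open>P[x_i = 1] under theta\<close>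
  sysf   :: "(nat \<Rightarrow> bool) \<Rightarrow> bool"

definition vecs :: "nat \<Rightarrow> (nat \<Rightarrow> bool) set" where
  "vecs n = {x. \<forall>i\<ge>n. \<not> x i}"

definition valid_game :: "nat \<Rightarrow> real \<Rightarrow> cm_game \<Rightarrow> bool" where
  "valid_game n H G \<longleftrightarrow> (\<forall>i<n. 0 \<le> rcost G i \<and> rcost G i \<le> H \<and> 0 \<le> prior G i \<and> prior G i \<le> 1)"

definition post_state :: "(nat \<Rightarrow> bool) \<Rightarrow> (nat \<Rightarrow> bool) \<Rightarrow> (nat \<Rightarrow> bool)" where
  "post_state x s = (\<lambda>i. x i \<or> s i)"

definition exp_phi :: "nat \<Rightarrow> cm_game \<Rightarrow> (nat \<Rightarrow> bool) \<Rightarrow> real" where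
  "exp_phi n G s = (\<Sum>x\<in>vecs n. (\<Prod>i<n. if x i then prior G i else 1 - prior G i)
                        * (if sysf G (post_state x s) then 1 else 0))"

definition agent_cost :: "nat \<Rightarrow> cm_game \<Rightarrow> (nat \<Rightarrow> bool) \<Rightarrow> nat \<Rightarrow> real" where
  "agent_cost n G s i = (if s i then rcost G i else 0) + 1 - exp_phi n G s"

definition subs_i :: "(nat \<Rightarrow> real) \<Rightarrow> (nat \<Rightarrow> bool) \<Rightarrow> nat \<Rightarrow> real" where
  "subs_i \<sigma> s i = (if s i then \<sigma> i else 0)"

definition subs_cost :: "nat \<Rightarrow> cm_game \<Rightarrow> (nat \<Rightarrow> real) \<Rightarrow> (nat \<Rightarrow> bool) \<Rightarrow> nat \<Rightarrow> real" where
  "subs_cost n G \<sigma> s i = agent_cost n G s i - subs_i \<sigma> s i"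

definition cost_sigma :: "nat \<Rightarrow> cm_game \<Rightarrow> (nat \<Rightarrow> real) \<Rightarrow> (nat \<Rightarrow> bool) \<Rightarrow> real" where
  "cost_sigma n G \<sigma> s = (\<Sum>i<n. subs_cost n G \<sigma> s i)"

definition subs_total :: "nat \<Rightarrow> (nat \<Rightarrow> real) \<Rightarrow> (nat \<Rightarrow> bool) \<Rightarrow> real" where
  "subs_total n \<sigma> s = (\<Sum>i<n. subs_i \<sigma> s i)"

definition pure_NE :: "nat \<Rightarrow> cm_game \<Rightarrow> (nat \<Rightarrow> real) \<Rightarrow> (nat \<Rightarrow> bool) set" where
  "pure_NE n G \<sigma> = {s \<in> vecs n. \<forall>i<n. \<forall>b.
      subs_cost n G \<sigma> s i \<le> subs_cost n G \<sigma> (s(i := b)) i}"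

definition loss :: "nat \<Rightarrow> cm_game \<Rightarrow> (nat \<Rightarrow> real) \<Rightarrow> real" where
  "loss n G \<sigma> = Max ((\<lambda>s. cost_sigma n G \<sigma> s + subs_total n \<sigma> s) ` pure_NE n G \<sigma>)"

definition subsidies :: "nat \<Rightarrow> real \<Rightarrow> (nat \<Rightarrow> real) set" where
  "subsidies n H = {\<sigma>. (\<forall>i<n. 0 \<le> \<sigma> i \<and> \<sigma> i \<le> H) \<and> (\<forall>i\<ge>n. \<sigma> i = 0)}"

definition avg_loss :: "nat \<Rightarrow> nat \<Rightarrow> (nat \<Rightarrow> cm_game) \<Rightarrow> (nat \<Rightarrow> real) \<Rightarrow> real" where
  "avg_loss n m S \<sigma> = (\<Sum>j<m. loss n (S j) \<sigma>) / real m"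

definition is_ERM :: "nat \<Rightarrow> real \<Rightarrow> nat \<Rightarrow> (nat \<Rightarrow> cm_game) \<Rightarrow> (nat \<Rightarrow> real) \<Rightarrow> bool" where
  "is_ERM n H m S \<sigma>h \<longleftrightarrow> \<sigma>h \<in> subsidies n H \<and> (\<forall>\<sigma>\<in>subsidies n H. avg_loss n m S \<sigma>h \<le> avg_loss n m S \<sigma>)"

definition exp_loss :: "nat \<Rightarrow> cm_game measure \<Rightarrow> (nat \<Rightarrow> real) \<Rightarrow> real" where
  "exp_loss n D \<sigma> = (\<integral>G. loss n G \<sigma> \<partial>D)"

end

theory Submission
  imports Defs
begin

text \<open>The loss of a game is the worst social cost of an equilibrium, and a subsidy vector
  \<open>\<sigma>\<close> matters only through the comparison of each \<open>\<sigma> i\<close> with at most \<open>2 ^ n\<close> thresholds of the game.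
  Cutting every axis into pieces that contain few thresholds in expectation gives, for every
  \<open>q\<close>, a partition of the subsidy space into at most \<open>(n * 2 ^ (n + 1) / q + 1) ^ n\<close> cells on each of which
  the loss is constant, except for games in an event of probability at most \<open>q\<close>.

  A union bound over a single fine partition would cost an extra factor \<open>ln (1 / \<epsilon>)\<close>. Instead one
  chains through the partitions with \<open>q = 2 ^ -k\<close>: the increment between two consecutive levels is nonzero with
  probability \<open>O(2 ^ -k)\<close>, so that a Bernstein bound outweighs the growing number of cells.

  Only the losses, not the thresholds, are measurable functions of the game. So the expected
  number of thresholds is replaced by a lower integral, and the exceptional events are expressed by
  losses at countably many subsidy vectors.\<close>

section \<open>Deviations of empirical means\<close>

lemma exp_le_quadratic:
  fixes x :: real
  assumes "\<bar>x\<bar> \<le> 1"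
  shows "exp x \<le> 1 + x + x\<^sup>2"
proof (cases "x \<ge> 0")
  case True
  then show ?thesis using assms exp_bound by auto
next
  case False
  define y where "y = - x"
  have y: "0 < y" "x = - y" using False by (auto simp: y_def)
  have "1 + y \<le> exp y" by simp
  then have "exp x \<le> 1 / (1 + y)"
    using y by (simp add: exp_minus divide_simps)
  \<comment> \<open>This holds because \<open>(1 + y) * (1 - y + y^2) = 1 + y^3\<close>, which is at
    least 1.\<close>
  also have "\<dots> \<le> 1 - y + y\<^sup>2"
    using y by (simp add: field_simps power2_eq_square)
  finally show ?thesis using y by simp
qed

definition emp_mean :: "nat \<Rightarrow> (nat \<Rightarrow> 'a) \<Rightarrow> ('a \<Rightarrow> real) \<Rightarrow> real" where
  "emp_mean m S X = (\<Sum>j<m. X (S j)) / real m"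

lemma emp_mean_diff: "emp_mean m S (\<lambda>x. X x - Y x) = emp_mean m S X - emp_mean m S Y"
  by (simp add: emp_mean_def sum_subtractf diff_divide_distrib)

lemma emp_mean_minus: "emp_mean m S (\<lambda>x. - X x) = - emp_mean m S X"
  by (simp add: emp_mean_def sum_negf)

lemma emp_mean_mono:
  assumes "\<And>j. j < m \<Longrightarrow> X (S j) \<le> Y (S j)"
  shows "emp_mean m S X \<le> emp_mean m S Y"
  unfolding emp_mean_def by (intro divide_right_mono sum_mono) (use assms in auto)

context prob_space
begin

text \<open>The quadratic bound on \<open>exp\<close> leaves \<open>1 + l^2 * Var X\<close>, and the
  variance is at most \<open>q\<close> because \<open>X^2\<close> never exceeds the indicator of
  \<open>X \<noteq> 0\<close>. As \<open>X\<close> deviates from its mean by at most 2,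
  \<open>l \<le> 1/2\<close> keeps the exponent in the range of that bound.\<close>

lemma expectation_exp_deviation_le:
  fixes X :: "'a \<Rightarrow> real"
  assumes X[measurable]: "X \<in> borel_measurable M"
    and bd: "\<And>x. x \<in> space M \<Longrightarrow> \<bar>X x\<bar> \<le> 1"
    and q: "prob {x \<in> space M. X x \<noteq> 0} \<le> q"
    and l: "0 \<le> l" "l \<le> 1/2"
  shows "expectation (\<lambda>x. exp (l * (expectation X - X x))) \<le> exp (l\<^sup>2 * q)"
    and "integrable M (\<lambda>x. exp (l * (expectation X - X x)))"
proof -
  define \<mu> where "\<mu> = expectation X"
  have intX: "integrable M X"
    by (rule integrable_const_bound[where B=1]) (use bd in auto)
  have intX2: "integrable M (\<lambda>x. (X x)\<^sup>2)"
    by (rule integrable_const_bound[where B=1]) (use bd in \<open>auto simp: abs_square_le_1\<close>)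
  have mu: "\<bar>\<mu>\<bar> \<le> 1"
  proof -
    have "\<bar>\<mu>\<bar> \<le> expectation (\<lambda>x. \<bar>X x\<bar>)"
      unfolding \<mu>_def by (rule integral_abs_bound)
    also have "\<dots> \<le> 1"
      using intX bd by (intro integral_le_const) auto
    finally show ?thesis .
  qed
  have small: "\<bar>l * (\<mu> - X x)\<bar> \<le> 1" if "x \<in> space M" for x
  proof -
    have "\<bar>\<mu> - X x\<bar> \<le> 2" using mu bd[OF that] by linarith
    then have "l * \<bar>\<mu> - X x\<bar> \<le> 1/2 * 2" using l by (intro mult_mono) auto
    then show ?thesis using l by (simp add: abs_mult)
  qed
  show int: "integrable M (\<lambda>x. exp (l * (expectation X - X x)))"
  proof (rule integrable_const_bound[where B="exp 1"])
    show "AE x in M. norm (exp (l * (expectation X - X x))) \<le> exp 1"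
      using small unfolding \<mu>_def by (intro AE_I2) (auto simp: abs_le_iff)
  qed measurable
  have X2: "expectation (\<lambda>x. (X x)\<^sup>2) \<le> q"
  proof -
    have "expectation (\<lambda>x. (X x)\<^sup>2) \<le> expectation (indicator {x \<in> space M. X x \<noteq> 0})"
      using intX2 bd
      by (intro integral_mono integrable_const_bound[where B=1 and f="indicator _"])
        (auto simp: indicator_def abs_square_le_1)
    also have "\<dots> = prob {x \<in> space M. X x \<noteq> 0}" by simp
    finally show ?thesis using q by simp
  qed
  have "expectation (\<lambda>x. exp (l * (\<mu> - X x)))
      \<le> expectation (\<lambda>x. 1 + l * (\<mu> - X x) + (l * (\<mu> - X x))\<^sup>2)"
  proof (rule integral_mono)
    show "integrable M (\<lambda>x. 1 + l * (\<mu> - X x) + (l * (\<mu> - X x))\<^sup>2)"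
      using intX intX2 by (auto simp: power_mult_distrib power2_diff)
  qed (use int small exp_le_quadratic in \<open>auto simp: \<mu>_def\<close>)
  also have "\<dots> = expectation (\<lambda>x. 1 + l * \<mu> + l\<^sup>2 * \<mu>\<^sup>2 - (l + 2 * l\<^sup>2 * \<mu>) * X x + l\<^sup>2 * (X x)\<^sup>2)"
    by (intro Bochner_Integration.integral_cong) (auto simp: power2_eq_square algebra_simps)
  also have "\<dots> = 1 + l * \<mu> + l\<^sup>2 * \<mu>\<^sup>2 - (l + 2 * l\<^sup>2 * \<mu>) * \<mu> + l\<^sup>2 * expectation (\<lambda>x. (X x)\<^sup>2)"
    using intX intX2 by (simp add: \<mu>_def prob_space)
  also have "\<dots> = 1 - l\<^sup>2 * \<mu>\<^sup>2 + l\<^sup>2 * expectation (\<lambda>x. (X x)\<^sup>2)"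
    by (simp add: algebra_simps power2_eq_square)
  also have "\<dots> \<le> 1 + l\<^sup>2 * q"
  proof -
    have "0 \<le> l\<^sup>2 * \<mu>\<^sup>2" by simp
    moreover have "l\<^sup>2 * expectation (\<lambda>x. (X x)\<^sup>2) \<le> l\<^sup>2 * q"
      using X2 by (rule mult_left_mono) simp
    ultimately show ?thesis by linarith
  qed
  also have "\<dots> \<le> exp (l\<^sup>2 * q)" by simp
  finally show "expectation (\<lambda>x. exp (l * (expectation X - X x))) \<le> exp (l\<^sup>2 * q)"
    by (simp add: \<mu>_def)
qed

lemma emp_mean_measurable [measurable]:
  assumes [measurable]: "X \<in> borel_measurable M"
  shows "(\<lambda>S. emp_mean m S X) \<in> borel_measurable (PiM {..<m} (\<lambda>_. M))"
  unfolding emp_mean_def by measurable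

text \<open>Unlike Hoeffding's inequality, this Bernstein-type bound improves for variables that
  rarely differ from zero.\<close>

lemma emp_mean_tail:
  fixes X :: "'a \<Rightarrow> real"
  assumes X[measurable]: "X \<in> borel_measurable M"
    and bd: "\<And>x. x \<in> space M \<Longrightarrow> \<bar>X x\<bar> \<le> 1"
    and q: "prob {x \<in> space M. X x \<noteq> 0} \<le> q"
    and t: "0 < t" "t \<le> q" and m: "0 < m"
  shows "measure (PiM {..<m} (\<lambda>_. M))
     {S \<in> space (PiM {..<m} (\<lambda>_. M)). t \<le> expectation X - emp_mean m S X}
     \<le> exp (- (real m * t\<^sup>2 / (4 * q)))"
proof -
  interpret P: product_sigma_finite "\<lambda>_::nat. M"
    by unfold_locales
  define \<mu> where "\<mu> = expectation X"
  \<comment> \<open>This \<open>l\<close> minimises the Chernoff exponent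
    \<open>m * l^2 * q - l * m * t\<close>; \<open>t \<le> q\<close> makes it at most 1/2.\<close>
  define l where "l = t / (2 * q)"
  have l: "0 < l" "l \<le> 1/2" using t by (auto simp: l_def field_simps)
  define u where "u = (\<lambda>S. \<Prod>j<m. exp (l * (\<mu> - X (S j))))"
  define c where "c = exp (l * real m * t)"
  note mgf = expectation_exp_deviation_le[OF X bd q, of l]
  have u_int: "integrable (PiM {..<m} (\<lambda>_. M)) u"
    unfolding u_def \<mu>_def by (rule P.product_integrable_prod) (use mgf l in auto)
  have "(\<integral>S. u S \<partial>PiM {..<m} (\<lambda>_. M)) = (\<Prod>j<m. expectation (\<lambda>x. exp (l * (\<mu> - X x))))"
    unfolding u_def \<mu>_def
    by (subst P.product_integral_prod[where f = "\<lambda>_ x. exp (l * (expectation X - X x))"])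
       (use mgf l in auto)
  also have "\<dots> \<le> exp (l\<^sup>2 * q) ^ m"
    using mgf(1) l by (auto simp: \<mu>_def intro!: power_mono)
  finally have u_le: "(\<integral>S. u S \<partial>PiM {..<m} (\<lambda>_. M)) \<le> exp (real m * (l\<^sup>2 * q))"
    by (simp add: exp_of_nat_mult)
  have "{S \<in> space (PiM {..<m} (\<lambda>_. M)). t \<le> expectation X - emp_mean m S X}
      = {S \<in> space (PiM {..<m} (\<lambda>_. M)). c \<le> u S}"
  proof -
    have "t \<le> \<mu> - emp_mean m S X \<longleftrightarrow> c \<le> u S" for S
    proof -
      have "u S = exp (l * (real m * (\<mu> - emp_mean m S X)))"
        using m by (simp add: u_def exp_sum[symmetric] sum_distrib_left[symmetric]
            sum_subtractf emp_mean_def right_diff_distrib)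
      then show ?thesis using l m by (simp add: c_def mult.assoc)
    qed
    then show ?thesis by (simp add: \<mu>_def)
  qed
  also have "measure (PiM {..<m} (\<lambda>_. M)) \<dots> \<le> (\<integral>S. u S \<partial>PiM {..<m} (\<lambda>_. M)) / c"
    by (rule integral_Markov_inequality_measure[OF u_int sets.empty_sets])
       (auto simp: u_def c_def intro!: prod_nonneg)
  also have "\<dots> \<le> exp (real m * (l\<^sup>2 * q)) / c"
    using u_le by (intro divide_right_mono) (auto simp: c_def)
  also have "\<dots> = exp (real m * (l\<^sup>2 * q) - l * real m * t)"
    by (simp add: c_def exp_diff)
  also have "real m * (l\<^sup>2 * q) - l * real m * t = - (real m * t\<^sup>2 / (4 * q))"
    using t by (simp add: l_def field_simps power2_eq_square)
  finally show ?thesis .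
qed

text \<open>A union bound over \<open>C\<close>, with \<open>budget\<close> as the logarithmic form
  of cardinality times tail. The bound is one-sided; the reverse direction comes from putting
  negated functions into \<open>C\<close>.\<close>

lemma emp_mean_uniform_tail:
  fixes C :: "('a \<Rightarrow> real) set"
  assumes fin: "finite C"
    and meas: "\<And>X. X \<in> C \<Longrightarrow> X \<in> borel_measurable M"
    and bd: "\<And>X x. X \<in> C \<Longrightarrow> x \<in> space M \<Longrightarrow> \<bar>X x\<bar> \<le> 1"
    and q: "\<And>X. X \<in> C \<Longrightarrow> prob {x \<in> space M. X x \<noteq> 0} \<le> q"
    and t: "0 < t" "t \<le> q" and m: "0 < m"
    and card: "real (card C) \<le> exp N"
    and budget: "N - real m * t\<^sup>2 / (4 * q) \<le> ln d" "0 < d"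
  obtains A where "A \<in> sets (PiM {..<m} (\<lambda>_. M))" "measure (PiM {..<m} (\<lambda>_. M)) A \<le> d"
    "\<And>S X. S \<in> space (PiM {..<m} (\<lambda>_. M)) - A \<Longrightarrow> X \<in> C \<Longrightarrow> expectation X \<le> emp_mean m S X + t"
proof
  let ?P = "PiM {..<m} (\<lambda>_. M)"
  define bad where "bad = (\<lambda>X. {S \<in> space ?P. t \<le> expectation X - emp_mean m S X})"
  have bad[measurable]: "bad X \<in> sets ?P" if "X \<in> C" for X
  proof -
    note [measurable] = meas[OF that]
    show ?thesis unfolding bad_def by measurable
  qed
  show "(\<Union>X\<in>C. bad X) \<in> sets ?P" using fin bad by auto
  have "measure ?P (\<Union>X\<in>C. bad X) \<le> (\<Sum>X\<in>C. measure ?P (bad X))"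
    by (intro measure_UNION_le fin bad)
  also have "\<dots> \<le> (\<Sum>X\<in>C. exp (- (real m * t\<^sup>2 / (4 * q))))"
    unfolding bad_def by (intro sum_mono emp_mean_tail meas bd q t m)
  also have "\<dots> \<le> exp N * exp (- (real m * t\<^sup>2 / (4 * q)))"
    using card by (simp add: mult_right_mono)
  also have "\<dots> = exp (N - real m * t\<^sup>2 / (4 * q))"
    by (simp add: exp_diff exp_minus field_simps)
  also have "\<dots> \<le> exp (ln d)" using budget(1) by (simp only: exp_le_cancel_iff)
  finally show "measure ?P (\<Union>X\<in>C. bad X) \<le> d" using budget by simp
  show "expectation X \<le> emp_mean m S X + t" if "S \<in> space ?P - (\<Union>X\<in>C. bad X)" "X \<in> C" for S X
    using that by (auto simp: bad_def)
qed

subsection \<open>Chaining\<close>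

text \<open>Split \<open>g \<sigma>\<close> into its representative at level 0, the increments
  between representatives up to a level \<open>K\<close>, and a remainder. The first costs
  \<open>\<epsilon> / 8\<close>, all increments together at most \<open>\<epsilon> / 8\<close>. The
  remainder vanishes off the exceptional event of level \<open>K\<close>, whose probability and
  empirical frequency add up to at most \<open>3 * (1/2)^K\<close>, hence to at most
  \<open>\<epsilon> / 4\<close>.\<close>

lemma uniform_deviation_chaining:
  fixes g :: "'s \<Rightarrow> 'a \<Rightarrow> real" and F :: "'s set"
    and \<kappa> :: "nat \<Rightarrow> 's \<Rightarrow> 'c" and E :: "nat \<Rightarrow> 'c \<Rightarrow> 'a set"
  assumes meas: "\<And>\<sigma>. \<sigma> \<in> F \<Longrightarrow> g \<sigma> \<in> borel_measurable M"
    and range: "\<And>\<sigma> x. \<sigma> \<in> F \<Longrightarrow> x \<in> space M \<Longrightarrow> 0 \<le> g \<sigma> x \<and> g \<sigma> x \<le> 1"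
    and fin: "\<And>k. finite (\<kappa> k ` F)"
    and card: "\<And>k. real (card (\<kappa> k ` F)) \<le> exp (V * (real k + 1))"
    and E: "\<And>k \<sigma>. \<sigma> \<in> F \<Longrightarrow> E k (\<kappa> k \<sigma>) \<in> events"
      "\<And>k \<sigma>. \<sigma> \<in> F \<Longrightarrow> prob (E k (\<kappa> k \<sigma>)) \<le> (1/2)^k"
    and const: "\<And>k \<sigma> \<sigma>' x. \<sigma> \<in> F \<Longrightarrow> \<sigma>' \<in> F \<Longrightarrow> \<kappa> k \<sigma> = \<kappa> k \<sigma>' \<Longrightarrow>
       x \<in> space M - E k (\<kappa> k \<sigma>) \<Longrightarrow> g \<sigma> x = g \<sigma>' x"
    and \<epsilon>: "0 < \<epsilon>" "\<epsilon> \<le> 1" and \<delta>: "0 < \<delta>" "\<delta> < 1" and V: "1 \<le> V"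
    and m: "real m * \<epsilon>\<^sup>2 \<ge> 2^18 * (V + ln (1 / \<delta>))"
  obtains A where "A \<in> sets (PiM {..<m} (\<lambda>_. M))" "measure (PiM {..<m} (\<lambda>_. M)) A \<le> \<delta>"
    "\<And>S \<sigma>. S \<in> space (PiM {..<m} (\<lambda>_. M)) - A \<Longrightarrow> \<sigma> \<in> F \<Longrightarrow>
       expectation (g \<sigma>) \<le> emp_mean m S (g \<sigma>) + \<epsilon> / 2"
proof -
  let ?P = "PiM {..<m} (\<lambda>_. M)"
  define L where "L = ln (1 / \<delta>)"
  define U where "U = V + L"
  have L: "0 < L" "ln \<delta> = - L" using \<delta> by (auto simp: L_def ln_div)
  have U: "1 \<le> U" "V \<le> U" "0 < U" using V L by (auto simp: U_def)
  have mU: "2^18 * U \<le> real m * \<epsilon>\<^sup>2" using m by (simp add: U_def L_def)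
  have m0: "0 < m" using mU U by (cases "m = 0") auto
  \<comment> \<open>The chain stops at the first level this fine. Minimality also gives
    \<open>\<epsilon> / 24 < (1/2)^K\<close>, so the last partition is not too large for
    \<open>m\<close> samples.\<close>
  have "\<exists>k. (1/2)^k \<le> \<epsilon> / 12"
    using real_arch_pow_inv[of "\<epsilon>/12" "1/2"] \<epsilon> by (auto intro: less_imp_le)
  then obtain K where K: "(1/2)^K \<le> \<epsilon> / 12" and K_least: "\<And>k. k < K \<Longrightarrow> \<epsilon> / 12 < (1/2)^k"
    using exists_least_iff[of "\<lambda>k. (1/2)^k \<le> \<epsilon> / 12"] by (auto simp: not_le)
  have K_low: "\<epsilon> / 24 < (1/2)^K"
  proof (cases K)
    case 0
    then show ?thesis using \<epsilon> by simp
  next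
    case (Suc k)
    then show ?thesis using K_least[of k] by simp
  qed

  \<comment> \<open>A representative depends on the cell alone, so there are no more functions to
    control than cells.\<close>
  define \<rho> where "\<rho> = (\<lambda>k c. SOME r. r \<in> F \<and> \<kappa> k r = c)"
  define rep where "rep = (\<lambda>k \<sigma>. \<rho> k (\<kappa> k \<sigma>))"
  have rep: "rep k \<sigma> \<in> F \<and> \<kappa> k (rep k \<sigma>) = \<kappa> k \<sigma>" if "\<sigma> \<in> F" for k \<sigma>
    unfolding rep_def \<rho>_def by (rule someI[of _ \<sigma>]) (use that in auto)
  have rep_eq: "g (rep k \<sigma>) x = g \<sigma> x" if "\<sigma> \<in> F" "x \<in> space M - E k (\<kappa> k \<sigma>)" for k \<sigma> x
    using const[of \<sigma> "rep k \<sigma>" k x] rep[of \<sigma> k] that by auto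
  have int: "integrable M (g \<sigma>)" if "\<sigma> \<in> F" for \<sigma>
    using range[OF that] meas[OF that] by (intro integrable_const_bound[where B=1]) auto

  \<comment> \<open>At the coarsest level no rarity is available, so the tail bound is used with
    \<open>q = 1\<close>.\<close>
  define C0 where "C0 = (\<lambda>\<sigma>. g (rep 0 \<sigma>)) ` F"
  have C0_eq: "C0 = (\<lambda>c. g (\<rho> 0 c)) ` \<kappa> 0 ` F" by (auto simp: C0_def rep_def)
  obtain A0 where A0: "A0 \<in> sets ?P" "measure ?P A0 \<le> \<delta> / 4"
    and A0_good: "\<And>S X. S \<in> space ?P - A0 \<Longrightarrow> X \<in> C0 \<Longrightarrow> expectation X \<le> emp_mean m S X + \<epsilon> / 8"
  proof (rule emp_mean_uniform_tail[of C0 1 "\<epsilon> / 8" m V "\<delta> / 4"])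
    show "finite C0" unfolding C0_eq using fin by auto
    have "card C0 \<le> card (\<kappa> 0 ` F)" unfolding C0_eq by (rule card_image_le[OF fin])
    then show "real (card C0) \<le> exp V" using card[of 0] by simp
    show "V - real m * (\<epsilon> / 8)\<^sup>2 / (4 * 1) \<le> ln (\<delta> / 4)"
    proof -
      have "real m * (\<epsilon> / 8)\<^sup>2 / (4 * 1) = real m * \<epsilon>\<^sup>2 / 256" by (simp add: power2_eq_square)
      moreover have "ln (4::real) \<le> 3" using ln_le_minus_one[of 4] by simp
      moreover have "ln (\<delta> / 4) = - L - ln 4" using \<delta> L by (simp add: ln_div)
      moreover have "V + L + 3 \<le> real m * \<epsilon>\<^sup>2 / 256" using mU U unfolding U_def by simp
      ultimately show ?thesis by linarith
    qed
  qed (use rep range meas \<epsilon> \<delta> m0 in \<open>auto simp: C0_def\<close>)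

  \<comment> \<open>The indicators are negated so that the one-sided tail bound limits the empirical
    frequency of the exceptional events from above.\<close>
  define CK where "CK = (\<lambda>\<sigma> x. - indicator (E K (\<kappa> K \<sigma>)) x :: real) ` F"
  have CK_eq: "CK = (\<lambda>c x. - indicator (E K c) x) ` \<kappa> K ` F" by (auto simp: CK_def)
  obtain AK where AK: "AK \<in> sets ?P" "measure ?P AK \<le> \<delta> / 4"
    and AK_good: "\<And>S X. S \<in> space ?P - AK \<Longrightarrow> X \<in> CK \<Longrightarrow> expectation X \<le> emp_mean m S X + (1/2)^K"
  proof (rule emp_mean_uniform_tail[of CK "(1/2)^K" "(1/2)^K" m "V * (real K + 1)" "\<delta> / 4"])
    show "finite CK" unfolding CK_eq using fin by auto
    have "card CK \<le> card (\<kappa> K ` F)" unfolding CK_eq by (rule card_image_le[OF fin])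
    then show "real (card CK) \<le> exp (V * (real K + 1))" using card[of K] by linarith
    show "X \<in> borel_measurable M" if "X \<in> CK" for X
      using that E(1) by (auto simp: CK_def)
    show "prob {x \<in> space M. X x \<noteq> 0} \<le> (1/2)^K" if X: "X \<in> CK" for X
    proof -
      obtain \<sigma> where \<sigma>: "\<sigma> \<in> F" "X = (\<lambda>x. - indicator (E K (\<kappa> K \<sigma>)) x)"
        using X by (auto simp: CK_def)
      then have "{x \<in> space M. X x \<noteq> 0} = E K (\<kappa> K \<sigma>)"
        using sets.sets_into_space[OF E(1)[OF \<sigma>(1), of K]] by (auto simp: indicator_def)
      then show ?thesis using E(2)[OF \<sigma>(1)] by simp
    qed
    show "V * (real K + 1) - real m * ((1/2)^K)\<^sup>2 / (4 * (1/2)^K) \<le> ln (\<delta> / 4)"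
    proof -
      \<comment> \<open>Since \<open>K + 1 \<le> 2^K < 24 / \<epsilon>\<close>, the hypothesis on
        \<open>m * \<epsilon>^2\<close> makes \<open>m * \<epsilon>\<close> dominate
        \<open>U * (K + 1)\<close>.\<close>
      have pow: "real K + 1 \<le> 2^K" using of_nat_mono[OF Suc_leI[OF less_exp[of K]], where 'a=real] by simp
      have "(real K + 1) / 24 \<le> 2^K / 24" using pow by (rule divide_right_mono) simp
      also have "\<dots> \<le> 1 / \<epsilon>"
        using K_low \<epsilon> by (simp add: field_simps power_one_over)
      finally have inv: "(real K + 1) / 24 \<le> 1 / \<epsilon>" .
      have "(2^18 * U) * ((real K + 1) / 24) \<le> (real m * \<epsilon>\<^sup>2) * (1 / \<epsilon>)"
        by (intro mult_mono mU inv) (use U in auto)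
      also have "\<dots> = real m * \<epsilon>"
        using \<epsilon> by (simp add: power2_eq_square)
      finally have a: "2^18 * (U * (real K + 1)) / (24 * 96) \<le> real m * \<epsilon> / 96"
        by (simp add: field_simps)
      have b: "real m * \<epsilon> / 96 \<le> real m * (1/2)^K / 4"
        using mult_left_mono[OF less_imp_le[OF K_low], of "real m"] by (simp add: field_simps)
      have "(L + 3) * 1 \<le> (L + 3) * (real K + 1)"
        by (rule mult_left_mono) (use L in auto)
      moreover have "(V + L + 3) * (real K + 1) \<le> (4 * U) * (real K + 1)"
        by (rule mult_right_mono) (use U in \<open>auto simp: U_def\<close>)
      ultimately have "V * (real K + 1) + L + 3 \<le> 4 * (U * (real K + 1))"
        by (simp add: algebra_simps)
      also have "\<dots> \<le> 2^18 * (U * (real K + 1)) / (24 * 96)" using U by simp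
      also note a also note b
      finally have c: "V * (real K + 1) + L + 3 \<le> real m * (1/2)^K / 4" .
      have "ln (4::real) \<le> 3" using ln_le_minus_one[of 4] by simp
      moreover have "ln (\<delta> / 4) = - L - ln 4" using \<delta> L by (simp add: ln_div)
      moreover have "real m * ((1/2)^K)\<^sup>2 / (4 * (1/2)^K) = real m * (1/2)^K / 4"
        by (simp add: power2_eq_square)
      ultimately show ?thesis using c by linarith
    qed
  qed (use \<delta> m0 in \<open>auto simp: CK_def indicator_def\<close>)

  \<comment> \<open>The tolerances \<open>\<epsilon> / 32 * (3/4)^k\<close> sum to at most
    \<open>\<epsilon> / 8\<close>, the failure probabilities \<open>\<delta> * (1/2)^(k + 2)\<close>
    to at most \<open>\<delta> / 2\<close>.\<close>
  define C where "C = (\<lambda>k. (\<lambda>\<sigma> x. g (rep (Suc k) \<sigma>) x - g (rep k \<sigma>) x) ` F)"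
  have "\<exists>A. A \<in> sets ?P \<and> measure ?P A \<le> \<delta> * (1/2)^(k + 2) \<and>
     (\<forall>S X. S \<in> space ?P - A \<longrightarrow> X \<in> C k \<longrightarrow> expectation X \<le> emp_mean m S X + \<epsilon> / 32 * (3/4)^k)"
    if k: "k < K" for k
  proof (rule emp_mean_uniform_tail[of "C k" "2 * (1/2)^k" "\<epsilon> / 32 * (3/4)^k" m "V * (2 * real k + 3)"
        "\<delta> * (1/2)^(k + 2)"])
    have C_eq: "C k = (\<lambda>(c, d) x. g (\<rho> (Suc k) d) x - g (\<rho> k c) x) ` (\<lambda>\<sigma>. (\<kappa> k \<sigma>, \<kappa> (Suc k) \<sigma>)) ` F"
      by (auto simp: C_def rep_def image_image)
    have sub: "(\<lambda>\<sigma>. (\<kappa> k \<sigma>, \<kappa> (Suc k) \<sigma>)) ` F \<subseteq> (\<kappa> k ` F) \<times> (\<kappa> (Suc k) ` F)" by auto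
    have fin': "finite ((\<lambda>\<sigma>. (\<kappa> k \<sigma>, \<kappa> (Suc k) \<sigma>)) ` F)"
      by (rule finite_subset[OF sub]) (use fin in auto)
    show "finite (C k)" unfolding C_eq using fin' by auto
    have "card (C k) \<le> card ((\<lambda>\<sigma>. (\<kappa> k \<sigma>, \<kappa> (Suc k) \<sigma>)) ` F)"
      unfolding C_eq by (rule card_image_le[OF fin'])
    also have "\<dots> \<le> card ((\<kappa> k ` F) \<times> (\<kappa> (Suc k) ` F))"
      by (rule card_mono[OF _ sub]) (use fin in auto)
    finally have "real (card (C k)) \<le> real (card (\<kappa> k ` F)) * real (card (\<kappa> (Suc k) ` F))"
      by (simp add: card_cartesian_product flip: of_nat_mult)
    also have "\<dots> \<le> exp (V * (real k + 1)) * exp (V * (real (Suc k) + 1))"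
      by (intro mult_mono card) auto
    also have "\<dots> = exp (V * (2 * real k + 3))"
      by (simp add: exp_add[symmetric] algebra_simps)
    finally show "real (card (C k)) \<le> exp (V * (2 * real k + 3))" .
    show "X \<in> borel_measurable M" if "X \<in> C k" for X
      using that rep meas by (auto simp: C_def intro!: borel_measurable_diff)
    show "\<bar>X x\<bar> \<le> 1" if X: "X \<in> C k" "x \<in> space M" for X x
    proof -
      obtain \<sigma> where "\<sigma> \<in> F" "X = (\<lambda>x. g (rep (Suc k) \<sigma>) x - g (rep k \<sigma>) x)"
        using X by (auto simp: C_def)
      then show ?thesis
        using range[of "rep (Suc k) \<sigma>" x] range[of "rep k \<sigma>" x] rep X(2) by (simp add: abs_le_iff)
    qed
    show "prob {x \<in> space M. X x \<noteq> 0} \<le> 2 * (1/2)^k" if X: "X \<in> C k" for X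
    proof -
      obtain \<sigma> where \<sigma>: "\<sigma> \<in> F" "X = (\<lambda>x. g (rep (Suc k) \<sigma>) x - g (rep k \<sigma>) x)"
        using X by (auto simp: C_def)
      \<comment> \<open>Outside both exceptional events the two representatives agree with
        \<open>g \<sigma>\<close>, so the increment vanishes.\<close>
      have "{x \<in> space M. X x \<noteq> 0} \<subseteq> E k (\<kappa> k \<sigma>) \<union> E (Suc k) (\<kappa> (Suc k) \<sigma>)"
      proof
        fix x assume x: "x \<in> {x \<in> space M. X x \<noteq> 0}"
        then have "g (rep (Suc k) \<sigma>) x \<noteq> g \<sigma> x \<or> g (rep k \<sigma>) x \<noteq> g \<sigma> x"
          by (auto simp: \<sigma>(2))
        then show "x \<in> E k (\<kappa> k \<sigma>) \<union> E (Suc k) (\<kappa> (Suc k) \<sigma>)"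
          using rep_eq[OF \<sigma>(1), of x k] rep_eq[OF \<sigma>(1), of x "Suc k"] x by blast
      qed
      then have "prob {x \<in> space M. X x \<noteq> 0} \<le> prob (E k (\<kappa> k \<sigma>) \<union> E (Suc k) (\<kappa> (Suc k) \<sigma>))"
        by (rule finite_measure_mono) (use E \<sigma> in auto)
      also have "\<dots> \<le> prob (E k (\<kappa> k \<sigma>)) + prob (E (Suc k) (\<kappa> (Suc k) \<sigma>))"
        by (rule measure_Un_le) (use E \<sigma> in auto)
      also have "\<dots> \<le> (1/2)^k + (1/2)^Suc k" by (intro add_mono E \<sigma>)
      also have "\<dots> \<le> 2 * (1/2)^k" by simp
      finally show ?thesis .
    qed
    show "0 < \<epsilon> / 32 * (3/4)^k" using \<epsilon> by simp
    have "\<epsilon> / 32 * (3/4)^k \<le> \<epsilon> / 32 * 1" using \<epsilon> by (intro mult_left_mono power_le_one) auto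
    then show "\<epsilon> / 32 * (3/4)^k \<le> 2 * (1/2)^k" using K_least[OF k] \<epsilon> by linarith
    show "V * (2 * real k + 3) - real m * (\<epsilon> / 32 * (3/4)^k)\<^sup>2 / (4 * (2 * (1/2)^k))
        \<le> ln (\<delta> * (1/2)^(k + 2))"
    proof -
      \<comment> \<open>The ratio 3/4 is chosen with square above 1/2: the tail exponent then grows
        like \<open>(9/8)^k\<close>, whereas the logarithm of the number of cells grows
        linearly.\<close>
      have "((3/4)^k)\<^sup>2 / (1/2)^k = ((9/8)^k :: real)"
        by (simp only: power_divide[symmetric] power_mult_distrib[symmetric] power2_eq_square) simp
      then have "real m * (\<epsilon> / 32 * (3/4)^k)\<^sup>2 / (4 * (2 * (1/2)^k)) = real m * \<epsilon>\<^sup>2 / 8192 * (9/8)^k"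
        by (simp add: power_mult_distrib power2_eq_square field_simps)
      moreover have "ln (\<delta> * (1/2)^(k + 2)) = - L - (real k + 2) * ln 2"
      proof -
        have "ln (\<delta> * (1/2)^(k + 2)) = ln \<delta> + ln ((1/2)^(k + 2))"
          using \<delta> by (intro ln_mult_pos) auto
        also have "ln ((1/2 :: real)^(k + 2)) = real (k + 2) * ln (1/2)"
          by (rule ln_realpow)
        also have "ln (1/2 :: real) = - ln 2" by (simp add: ln_div)
        finally show ?thesis using L by simp
      qed
      moreover have "V * (2 * real k + 3) + L + (real k + 2) * ln 2 \<le> real m * \<epsilon>\<^sup>2 / 8192 * (9/8)^k"
      proof -
        have "(real k + 2) * ln 2 \<le> (real k + 2) * V"
          using ln_le_minus_one[of 2] V by (intro mult_left_mono) auto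
        moreover have "V * (3 * real k + 5) \<le> U * (3 * real k + 5)" "L \<le> U"
          using U V by (auto intro!: mult_right_mono simp: U_def)
        ultimately have "V * (2 * real k + 3) + L + (real k + 2) * ln 2 \<le> U * (3 * real k + 6)"
          by (simp add: algebra_simps)
        also have "\<dots> \<le> U * (32 + 4 * real k)"
          using U by (intro mult_left_mono) auto
        \<comment> \<open>As \<open>2^18 / 8192 = 32\<close>, the right factor becomes the linear
          lower bound on \<open>(9/8)^k\<close> given by Bernoulli's inequality.\<close>
        also have "\<dots> = (2^18 * U) / 8192 * (1 + real k * (1/8))" by (simp add: algebra_simps)
        also have "\<dots> \<le> real m * \<epsilon>\<^sup>2 / 8192 * (9/8)^k"
        proof (rule mult_mono)
          show "(2^18 * U) / 8192 \<le> real m * \<epsilon>\<^sup>2 / 8192" using mU by (rule divide_right_mono) simp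
          show "1 + real k * (1/8) \<le> (9/8 :: real)^k" using Bernoulli_inequality[of "1/8" k] by simp
        qed (use U in auto)
        finally show ?thesis .
      qed
      ultimately show ?thesis by linarith
    qed
  qed (use \<delta> m0 in auto)
  then obtain A where A: "\<And>k. k < K \<Longrightarrow> A k \<in> sets ?P" "\<And>k. k < K \<Longrightarrow> measure ?P (A k) \<le> \<delta> * (1/2)^(k + 2)"
    and A_good: "\<And>k S X. k < K \<Longrightarrow> S \<in> space ?P - A k \<Longrightarrow> X \<in> C k \<Longrightarrow>
       expectation X \<le> emp_mean m S X + \<epsilon> / 32 * (3/4)^k"
    by metis

  define B where "B = A0 \<union> AK \<union> (\<Union>k<K. A k)"
  show thesis
  proof
    show "B \<in> sets ?P" unfolding B_def using A0 AK A by auto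
    have "measure ?P B \<le> measure ?P A0 + measure ?P AK + measure ?P (\<Union>k<K. A k)"
      unfolding B_def using A0 AK A
      by (intro order_trans[OF measure_Un_le] add_mono measure_Un_le) auto
    also have "\<dots> \<le> \<delta> / 4 + \<delta> / 4 + (\<Sum>k<K. \<delta> * (1/2)^(k + 2))"
      using A by (intro add_mono A0 AK order_trans[OF measure_UNION_le] sum_mono) auto
    also have "(\<Sum>k<K. \<delta> * (1/2)^(k + 2)) = \<delta> / 4 * (\<Sum>k<K. (1/2)^k)"
      by (simp add: sum_distrib_left power_add mult_ac)
    also have "(\<Sum>k<K. (1/2)^k) = 2 * (1 - (1/2)^K :: real)"
      by (induction K) (auto simp: algebra_simps)
    also have "\<delta> / 4 * (2 * (1 - (1/2)^K)) \<le> \<delta> / 4 * 2"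
      using \<delta> by (intro mult_left_mono) auto
    finally show "measure ?P B \<le> \<delta>" by simp
    fix S \<sigma> assume S: "S \<in> space ?P - B" and \<sigma>: "\<sigma> \<in> F"
    have Sj: "S j \<in> space M" if "j < m" for j
      using S that by (auto simp: space_PiM PiE_def Pi_def)
    \<comment> \<open>The last term is the sum of the tolerances
      \<open>\<epsilon> / 32 * (3/4)^j\<close> over \<open>j < k\<close>.\<close>
    have chain: "expectation (g (rep k \<sigma>)) \<le> emp_mean m S (g (rep k \<sigma>)) + \<epsilon> / 8 + \<epsilon> / 8 * (1 - (3/4)^k)"
      if "k \<le> K" for k
      using that
    proof (induction k)
      case 0
      show ?case using A0_good[of S "g (rep 0 \<sigma>)"] S \<sigma> by (auto simp: B_def C0_def)
    next
      case (Suc k)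
      have "expectation (\<lambda>x. g (rep (Suc k) \<sigma>) x - g (rep k \<sigma>) x)
         \<le> emp_mean m S (\<lambda>x. g (rep (Suc k) \<sigma>) x - g (rep k \<sigma>) x) + \<epsilon> / 32 * (3/4)^k"
        using Suc.prems S \<sigma> by (intro A_good) (auto simp: B_def C_def)
      then show ?case
        using Suc rep[OF \<sigma>] int by (simp add: emp_mean_diff algebra_simps)
    qed
    let ?E = "E K (\<kappa> K \<sigma>)" and ?r = "rep K \<sigma>"
    have r: "?r \<in> F" using rep \<sigma> by blast
    have diff: "\<bar>g \<sigma> x - g ?r x\<bar> \<le> indicator ?E x" if "x \<in> space M" for x
      using rep_eq[OF \<sigma>, of x K] range[OF \<sigma> that] range[OF r that] that
      by (auto simp: indicator_def)
    have "expectation (\<lambda>x. g \<sigma> x - g ?r x) \<le> expectation (indicator ?E)"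
      using int \<sigma> r E(1)[OF \<sigma>] diff
      by (intro integral_mono integrable_real_indicator) (auto simp: abs_le_iff emeasure_eq_measure)
    then have 1: "expectation (g \<sigma>) \<le> expectation (g ?r) + prob ?E"
      using int \<sigma> r E(1)[OF \<sigma>] by simp
    have "expectation (\<lambda>x. - indicator ?E x) \<le> emp_mean m S (\<lambda>x. - indicator ?E x) + (1/2)^K"
      using S \<sigma> by (intro AK_good) (auto simp: B_def CK_def)
    then have 2: "emp_mean m S (indicator ?E) \<le> prob ?E + (1/2)^K"
      using E(1)[OF \<sigma>] by (simp add: emp_mean_minus)
    have "emp_mean m S (\<lambda>x. g ?r x - g \<sigma> x) \<le> emp_mean m S (indicator ?E)"
      using diff[OF Sj] by (intro emp_mean_mono) (auto simp: abs_le_iff)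
    then have 3: "emp_mean m S (g ?r) \<le> emp_mean m S (g \<sigma>) + emp_mean m S (indicator ?E)"
      by (simp add: emp_mean_diff)
    have "\<epsilon> / 8 * (1 - (3/4)^K) \<le> \<epsilon> / 8 * 1"
      using \<epsilon> by (intro mult_left_mono) auto
    then show "expectation (g \<sigma>) \<le> emp_mean m S (g \<sigma>) + \<epsilon> / 2"
      using 1 2 3 chain[of K] E(2)[OF \<sigma>, of K] K by simp
  qed
qed

end

section \<open>Equilibria and thresholds\<close>

lemma finite_vecs: "finite (vecs n)" and card_vecs: "card (vecs n) = 2 ^ n"
proof -
  have "bij_betw (\<lambda>x. {i. x i}) (vecs n) (Pow {..<n})"
    by (rule bij_betw_byWitness[where f' = "\<lambda>A i. i \<in> A"])
       (auto simp: vecs_def not_le[symmetric])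
  then show "finite (vecs n)" "card (vecs n) = 2 ^ n"
    using bij_betw_finite bij_betw_same_card by (fastforce simp: card_Pow)+
qed

lemma vecs_upd: "s \<in> vecs n \<Longrightarrow> i < n \<Longrightarrow> s(i := b) \<in> vecs n"
  by (auto simp: vecs_def)

text \<open>Induction on the number of components: splitting the states by whether the last
  component works multiplies the total weight by \<open>(1 - p n) + p n\<close>.\<close>

lemma sum_vecs_product:
  "(\<Sum>x\<in>vecs n. \<Prod>i<n. if x i then p i else 1 - p i) = (1::real)"
proof (induction n)
  case 0
  have "vecs 0 = {\<lambda>_. False}" by (auto simp: vecs_def)
  then show ?case by simp
next
  case (Suc n)
  have split: "vecs (Suc n) = vecs n \<union> (\<lambda>x. x(n := True)) ` vecs n"
  proof (intro set_eqI iffI)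
    fix x assume x: "x \<in> vecs (Suc n)"
    show "x \<in> vecs n \<union> (\<lambda>x. x(n := True)) ` vecs n"
    proof (cases "x n")
      case True
      have "x = (x(n := False))(n := True)" using True by (auto simp: fun_eq_iff)
      moreover have "x(n := False) \<in> vecs n" using x by (auto simp: vecs_def le_Suc_eq)
      ultimately show ?thesis by blast
    next
      case False
      have "\<not> x i" if "n \<le> i" for i
        using that x False by (cases "i = n") (simp_all add: vecs_def)
      then have "x \<in> vecs n" by (simp add: vecs_def)
      then show ?thesis by blast
    qed
  qed (auto simp: vecs_def)
  have notn: "\<not> x n" if "x \<in> vecs n" for x using that by (auto simp: vecs_def)
  have inj: "inj_on (\<lambda>x. x(n := True)) (vecs n)"
  proof (rule inj_onI)
    fix x y assume xy: "x \<in> vecs n" "y \<in> vecs n" "x(n := True) = y(n := True)"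
    show "x = y"
    proof
      fix i show "x i = y i"
        using fun_cong[OF xy(3), of i] notn[OF xy(1)] notn[OF xy(2)] by (cases "i = n") auto
    qed
  qed
  have disj: "vecs n \<inter> (\<lambda>x. x(n := True)) ` vecs n = {}"
    using notn by (metis (no_types, lifting) disjoint_iff fun_upd_same imageE)
  let ?w = "\<lambda>n x. \<Prod>i<n. if x i then p i else 1 - p i"
  have "(\<Sum>x\<in>vecs (Suc n). ?w (Suc n) x)
      = (\<Sum>x\<in>vecs n. ?w (Suc n) x) + (\<Sum>x\<in>vecs n. ?w (Suc n) (x(n := True)))"
    unfolding split
    by (subst sum.union_disjoint) (use finite_vecs disj inj in \<open>auto simp: sum.reindex\<close>)
  also have "\<dots> = (\<Sum>x\<in>vecs n. ?w n x * (1 - p n)) + (\<Sum>x\<in>vecs n. ?w n x * p n)"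
    using notn by (intro arg_cong2[of _ _ _ _ "(+)"] sum.cong) (auto intro!: prod.cong)
  also have "\<dots> = 1" using Suc by (simp add: sum_distrib_right[symmetric])
  finally show ?case .
qed

lemma exp_phi_bounds:
  assumes "valid_game n H G"
  shows "0 \<le> exp_phi n G s" "exp_phi n G s \<le> 1"
proof -
  let ?w = "\<lambda>x. \<Prod>i<n. if x i then prior G i else 1 - prior G i"
  have w: "0 \<le> ?w x" for x
    by (rule prod_nonneg) (use assms in \<open>auto simp: valid_game_def\<close>)
  show "0 \<le> exp_phi n G s"
    unfolding exp_phi_def by (rule sum_nonneg) (use w in auto)
  have "exp_phi n G s \<le> (\<Sum>x\<in>vecs n. ?w x)"
    unfolding exp_phi_def by (rule sum_mono) (use w in auto)
  then show "exp_phi n G s \<le> 1" by (simp add: sum_vecs_product)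
qed

section \<open>Subsidies as transfers, best responses and equilibria\<close>

definition social_cost :: "nat \<Rightarrow> cm_game \<Rightarrow> (nat \<Rightarrow> bool) \<Rightarrow> real" where
  "social_cost n G s = (\<Sum>i<n. agent_cost n G s i)"

text \<open>The subsidies deducted from the agents' costs are added back as expenditure, so
  \<open>\<sigma>\<close> affects the loss only through the set of equilibria.\<close>

lemma loss_eq_Max_social_cost: "loss n G \<sigma> = Max (social_cost n G ` pure_NE n G \<sigma>)"
  by (simp add: loss_def cost_sigma_def subs_total_def subs_cost_def social_cost_def sum_subtractf)

text \<open>The subsidy at which agent \<open>i\<close> is indifferent between its two actions while
  the others follow \<open>s\<close>; the entry \<open>s i\<close> is overwritten and has no
  influence.\<close>

definition switch_cost :: "nat \<Rightarrow> cm_game \<Rightarrow> nat \<Rightarrow> (nat \<Rightarrow> bool) \<Rightarrow> real" where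
  "switch_cost n G i s = rcost G i - (exp_phi n G (s(i := True)) - exp_phi n G (s(i := False)))"

text \<open>With two actions there is a single deviation to compare with. Both comparisons are
  non-strict, so a tie supports either action.\<close>

lemma pure_NE_iff:
  "s \<in> pure_NE n G \<sigma> \<longleftrightarrow> s \<in> vecs n \<and>
     (\<forall>i<n. if s i then switch_cost n G i s \<le> \<sigma> i else \<sigma> i \<le> switch_cost n G i s)"
proof -
  have "(\<forall>b. subs_cost n G \<sigma> s i \<le> subs_cost n G \<sigma> (s(i := b)) i) \<longleftrightarrow>
      (if s i then switch_cost n G i s \<le> \<sigma> i else \<sigma> i \<le> switch_cost n G i s)" for i
  proof -
    have "s(i := s i) = s" by simp
    then show ?thesis
      by (cases "s i")
         (auto simp: all_bool_eq subs_cost_def agent_cost_def subs_i_def switch_cost_def)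
  qed
  then show ?thesis by (auto simp: pure_NE_def)
qed

text \<open>The game has an exact potential, so a minimiser of the potential is an equilibrium. In
  particular the maximum in the loss is never taken over the empty set.\<close>

lemma pure_NE_nonempty: "pure_NE n G \<sigma> \<noteq> {}"
proof -
  \<comment> \<open>The failure probability is common to all agents, so counting it once next to the
    net repair costs makes every unilateral change of \<open>\<Phi>\<close> equal to the deviator's
    change of cost.\<close>
  define \<Phi> where "\<Phi> = (\<lambda>s. (\<Sum>i<n. if s i then rcost G i - \<sigma> i else 0) - exp_phi n G s)"
  have "vecs n \<noteq> {}" by (auto simp: vecs_def)
  then obtain s where s: "s \<in> vecs n" "\<And>s'. s' \<in> vecs n \<Longrightarrow> \<Phi> s \<le> \<Phi> s'"
    using ex_is_arg_min_if_finite[OF finite_vecs, of n \<Phi>] by (auto simp: is_arg_min_linorder)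
  have "subs_cost n G \<sigma> s i \<le> subs_cost n G \<sigma> (s(i := b)) i" if i: "i < n" for i b
  proof -
    have "(\<Sum>j<n. if t j then rcost G j - \<sigma> j else 0)
       = (if t i then rcost G i - \<sigma> i else 0) + (\<Sum>j\<in>{..<n}-{i}. if t j then rcost G j - \<sigma> j else 0)" for t
      using i by (subst sum.remove[of _ i]) auto
    moreover have "(\<Sum>j\<in>{..<n}-{i}. if (s(i := b)) j then rcost G j - \<sigma> j else 0)
       = (\<Sum>j\<in>{..<n}-{i}. if s j then rcost G j - \<sigma> j else 0)"
      by (rule sum.cong) auto
    ultimately have "\<Phi> (s(i := b)) - \<Phi> s = subs_cost n G \<sigma> (s(i := b)) i - subs_cost n G \<sigma> s i"
      by (simp add: \<Phi>_def subs_cost_def agent_cost_def subs_i_def del: fun_upd_apply)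
    then show ?thesis using s(2)[OF vecs_upd[OF s(1) i, of b]] by linarith
  qed
  then show ?thesis using s(1) by (auto simp: pure_NE_def)
qed

lemma finite_pure_NE: "finite (pure_NE n G \<sigma>)"
  by (rule finite_subset[OF _ finite_vecs[of n]]) (auto simp: pure_NE_def)

lemma loss_attained:
  obtains s where "s \<in> pure_NE n G \<sigma>" "loss n G \<sigma> = social_cost n G s"
  using Max_in[of "social_cost n G ` pure_NE n G \<sigma>"] finite_pure_NE pure_NE_nonempty
  unfolding loss_eq_Max_social_cost by (metis (no_types, lifting) finite_imageI image_iff image_is_empty)

lemma social_cost_le_loss: "s \<in> pure_NE n G \<sigma> \<Longrightarrow> social_cost n G s \<le> loss n G \<sigma>"
  unfolding loss_eq_Max_social_cost by (rule Max_ge) (auto simp: finite_pure_NE)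

text \<open>Each agent pays at most \<open>H\<close> for repair and at most 1, hence at most
  \<open>H\<close>, for the failure of the system.\<close>

lemma loss_bounds:
  assumes "valid_game n H G" "1 \<le> H"
  shows "0 \<le> loss n G \<sigma>" "loss n G \<sigma> \<le> 2 * real n * H"
proof -
  obtain s where s: "loss n G \<sigma> = social_cost n G s" by (rule loss_attained)
  have b: "0 \<le> agent_cost n G s i \<and> agent_cost n G s i \<le> 2 * H" if "i < n" for i
    using that assms exp_phi_bounds[OF assms(1), of s]
    unfolding agent_cost_def valid_game_def by (auto split: if_splits)
  show "0 \<le> loss n G \<sigma>" unfolding s social_cost_def by (rule sum_nonneg) (use b in auto)
  have "social_cost n G s \<le> (\<Sum>i<n. 2 * H)" unfolding social_cost_def by (rule sum_mono) (use b in auto)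
  then show "loss n G \<sigma> \<le> 2 * real n * H" unfolding s by simp
qed

section \<open>Thresholds and the changes of the loss along one axis\<close>

definition thresholds :: "nat \<Rightarrow> cm_game \<Rightarrow> nat \<Rightarrow> real set" where
  "thresholds n G i = switch_cost n G i ` vecs n"

lemma finite_thresholds: "finite (thresholds n G i)"
  by (simp add: thresholds_def finite_vecs)

lemma card_thresholds_le: "card (thresholds n G i) \<le> 2 ^ n"
  unfolding thresholds_def using card_image_le[OF finite_vecs] card_vecs by metis

text \<open>A threshold inside \<open>[a, b]\<close> makes \<open>below_count\<close> grow by at least 1 from \<open>a\<close> to \<open>b > a\<close>,
  even if it coincides with one of the endpoints; this is why each threshold is counted twice.\<close>

definition below_count :: "nat \<Rightarrow> cm_game \<Rightarrow> nat \<Rightarrow> real \<Rightarrow> real" where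
  "below_count n G i x = real (card {t \<in> thresholds n G i. t < x} + card {t \<in> thresholds n G i. t \<le> x})"

lemma below_count_nonneg: "0 \<le> below_count n G i x"
  by (simp add: below_count_def)

lemma below_count_le: "below_count n G i x \<le> 2 ^ (n + 1)"
proof -
  have "card {t \<in> thresholds n G i. t < x} \<le> 2 ^ n" "card {t \<in> thresholds n G i. t \<le> x} \<le> 2 ^ n"
    by (rule order_trans[OF card_mono card_thresholds_le]; use finite_thresholds in auto)+
  then have "card {t \<in> thresholds n G i. t < x} + card {t \<in> thresholds n G i. t \<le> x} \<le> 2 ^ (n + 1)"
    by simp
  then show ?thesis unfolding below_count_def by (metis of_nat_le_iff of_nat_numeral of_nat_power)
qed

lemma below_count_mono: "x \<le> y \<Longrightarrow> below_count n G i x \<le> below_count n G i y"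
  unfolding below_count_def of_nat_le_iff
  by (intro add_mono card_mono) (use finite_thresholds in auto)

lemma below_count_step:
  assumes "a < b" "t \<in> thresholds n G i" "a \<le> t" "t \<le> b"
  shows "below_count n G i a + 1 \<le> below_count n G i b"
proof -
  let ?T = "thresholds n G i"
  have mono: "card {t \<in> ?T. t < a} \<le> card {t \<in> ?T. t < b}" "card {t \<in> ?T. t \<le> a} \<le> card {t \<in> ?T. t \<le> b}"
    using assms by (auto intro!: card_mono simp: finite_thresholds)
  have "card {t \<in> ?T. t < a} < card {t \<in> ?T. t < b} \<or> card {t \<in> ?T. t \<le> a} < card {t \<in> ?T. t \<le> b}"
  proof (cases "t < b")
    case True
    have "t \<in> {t \<in> ?T. t < b} - {t \<in> ?T. t < a}" using assms True by simp
    moreover have "{t \<in> ?T. t < a} \<subseteq> {t \<in> ?T. t < b}" using assms by auto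
    ultimately have "{t \<in> ?T. t < a} \<subset> {t \<in> ?T. t < b}" by blast
    then show ?thesis by (intro disjI1 psubset_card_mono) (simp_all add: finite_thresholds)
  next
    case False
    have "t \<in> {t \<in> ?T. t \<le> b} - {t \<in> ?T. t \<le> a}" using assms False by simp
    moreover have "{t \<in> ?T. t \<le> a} \<subseteq> {t \<in> ?T. t \<le> b}" using assms by auto
    ultimately have "{t \<in> ?T. t \<le> a} \<subset> {t \<in> ?T. t \<le> b}" by blast
    then show ?thesis by (intro disjI2 psubset_card_mono) (simp_all add: finite_thresholds)
  qed
  then show ?thesis using mono unfolding below_count_def by linarith
qed

text \<open>With no threshold in the closed interval, \<open>a\<close> and \<open>b\<close> compare
  alike with every switch cost of agent \<open>i\<close>, and the equilibria coincide. The endpoints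
  are included because the value at a tie has more equilibria than its neighbours may have.\<close>

lemma loss_upd_eq:
  assumes "a \<le> b" "\<And>t. t \<in> thresholds n G i \<Longrightarrow> \<not> (a \<le> t \<and> t \<le> b)"
  shows "loss n G (\<sigma>(i := a)) = loss n G (\<sigma>(i := b))"
proof -
  have "switch_cost n G i s \<le> a \<longleftrightarrow> switch_cost n G i s \<le> b"
    "a \<le> switch_cost n G i s \<longleftrightarrow> b \<le> switch_cost n G i s" if "s \<in> vecs n" for s
    using assms(1) assms(2)[of "switch_cost n G i s"] that by (auto simp: thresholds_def)
  then have "pure_NE n G (\<sigma>(i := a)) = pure_NE n G (\<sigma>(i := b))"
    unfolding set_eq_iff pure_NE_iff by auto
  then show ?thesis by (simp add: loss_eq_Max_social_cost)
qed

lemma below_count_ge_of_loss_change: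
  assumes "a \<le> b" "loss n G (\<sigma>(i := a)) \<noteq> loss n G (\<sigma>(i := b))"
  shows "below_count n G i a + 1 \<le> below_count n G i b"
proof -
  have "a < b" using assms by (cases "a = b") auto
  then show ?thesis using loss_upd_eq[OF assms(1), of n G i \<sigma>] below_count_step assms by metis
qed

text \<open>The set of subsidies supporting \<open>s\<close> is an orthant, so one may move away from \<open>\<sigma>\<close> inside
  the orthant of a worst equilibrium; a small move creates no new equilibrium.\<close>

lemma loss_eq_nearby:
  obtains s r where "0 < r"
    "\<And>\<sigma>'. (\<And>i. i < n \<Longrightarrow> \<bar>\<sigma>' i - \<sigma> i\<bar> < r) \<Longrightarrow>
       (\<And>i. i < n \<Longrightarrow> if s i then \<sigma> i \<le> \<sigma>' i else \<sigma>' i \<le> \<sigma> i) \<Longrightarrow> loss n G \<sigma>' = loss n G \<sigma>"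
proof -
  obtain s where s: "s \<in> pure_NE n G \<sigma>" "loss n G \<sigma> = social_cost n G s" by (rule loss_attained)
  \<comment> \<open>The positive distances from \<open>\<sigma> i\<close> to thresholds; inserting 1
    keeps the minimum defined when there are none.\<close>
  define R where "R = insert 1 ((\<Union>i<n. (\<lambda>t. \<bar>t - \<sigma> i\<bar>) ` thresholds n G i) - {0})"
  define r where "r = Min R"
  have R: "finite R" "R \<noteq> {}" "\<forall>x\<in>R. 0 < x" by (auto simp: R_def finite_thresholds)
  have r: "0 < r" "\<And>x. x \<in> R \<Longrightarrow> r \<le> x" using R by (auto simp: r_def)
  show thesis
  proof (rule that[OF r(1)])
    fix \<sigma>' assume near: "\<And>i. i < n \<Longrightarrow> \<bar>\<sigma>' i - \<sigma> i\<bar> < r"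
      and dir: "\<And>i. i < n \<Longrightarrow> if s i then \<sigma> i \<le> \<sigma>' i else \<sigma>' i \<le> \<sigma> i"
    have sep: "t = \<sigma> i \<or> \<bar>\<sigma>' i - \<sigma> i\<bar> < \<bar>t - \<sigma> i\<bar>" if "i < n" "t \<in> thresholds n G i" for i t
      using near[OF that(1)] r(2)[of "\<bar>t - \<sigma> i\<bar>"] that by (cases "t = \<sigma> i") (auto simp: R_def intro: less_le_trans)
    \<comment> \<open>A threshold different from \<open>\<sigma> i\<close> is not reached by the
      move, and one equal to \<open>\<sigma> i\<close> satisfies both comparisons at
      \<open>\<sigma>\<close>.\<close>
    have sub: "pure_NE n G \<sigma>' \<subseteq> pure_NE n G \<sigma>"
    proof
      fix u assume u: "u \<in> pure_NE n G \<sigma>'"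
      then have uv: "u \<in> vecs n" by (simp add: pure_NE_iff)
      have "if u i then switch_cost n G i u \<le> \<sigma> i else \<sigma> i \<le> switch_cost n G i u" if i: "i < n" for i
      proof -
        have "switch_cost n G i u \<in> thresholds n G i" using uv by (auto simp: thresholds_def)
        from sep[OF i this] show ?thesis using u i unfolding pure_NE_iff by (auto split: if_splits)
      qed
      then show "u \<in> pure_NE n G \<sigma>" using uv by (simp add: pure_NE_iff)
    qed
    \<comment> \<open>Each coordinate moves in the direction that favours the action prescribed by
      \<open>s\<close>.\<close>
    have "s \<in> pure_NE n G \<sigma>'"
      using s(1) dir unfolding pure_NE_iff by (smt (verit))
    then have "social_cost n G s \<le> loss n G \<sigma>'" by (rule social_cost_le_loss)
    moreover have "loss n G \<sigma>' \<le> loss n G \<sigma>"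
      using loss_attained[of n G \<sigma>'] social_cost_le_loss sub by (metis subsetD)
    ultimately show "loss n G \<sigma>' = loss n G \<sigma>" using s(2) by linarith
  qed
qed

section \<open>Partition of the subsidy space\<close>

text \<open>\<open>F x\<close> is the lower integral of \<open>h x\<close>, which need not be measurable. For non-measurable
  functions lower integrals are still superadditive.\<close>

lemma (in prob_space) lower_integral_superadditive:
  fixes h :: "real \<Rightarrow> 'a \<Rightarrow> real"
  assumes h: "\<And>x w. w \<in> space M \<Longrightarrow> 0 \<le> h x w \<and> h x w \<le> B"
  obtains F where "\<And>x. 0 \<le> F x" "\<And>x. F x \<le> B"
    "\<And>a b A. A \<in> events \<Longrightarrow> (\<And>w. w \<in> space M \<Longrightarrow> h a w + indicator A w \<le> h b w) \<Longrightarrow>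
       F a + prob A \<le> F b"
proof -
  define minorants where "minorants = (\<lambda>x. {g \<in> borel_measurable M. \<forall>w\<in>space M. 0 \<le> g w \<and> g w \<le> h x w})"
  define F where "F = (\<lambda>x. SUP g\<in>minorants x. expectation g)"
  have zero: "(\<lambda>_. 0) \<in> minorants x" for x using h by (auto simp: minorants_def)
  have minorant: "g \<in> borel_measurable M" "\<And>w. w \<in> space M \<Longrightarrow> 0 \<le> g w \<and> g w \<le> B"
    if "g \<in> minorants x" for g x
    using that h order_trans by (auto simp: minorants_def) blast
  have int: "integrable M g" if "g \<in> minorants x" for g x
    using minorant[OF that] by (intro integrable_const_bound[where B=B]) auto
  have le: "expectation g \<le> B" if "g \<in> minorants x" for g x
    using minorant[OF that] int[OF that] by (intro integral_le_const) auto
  have bdd: "bdd_above (expectation ` minorants x)" for x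
    using le by (auto intro!: bdd_aboveI2)
  show thesis
  proof
    show "0 \<le> F x" for x
      unfolding F_def using cSUP_upper[OF zero bdd, of x] by simp
    show "F x \<le> B" for x
      unfolding F_def using zero le by (intro cSUP_least) auto
    fix a b A assume A: "A \<in> events" and hab: "\<And>w. w \<in> space M \<Longrightarrow> h a w + indicator A w \<le> h b w"
    have "expectation g \<le> F b - prob A" if g: "g \<in> minorants a" for g
    proof -
      \<comment> \<open>Measurability of \<open>A\<close> is what lets its indicator be added to a
        measurable minorant.\<close>
      have "(\<lambda>w. g w + indicator A w) \<in> minorants b"
        using g A hab unfolding minorants_def by (fastforce intro: order_trans)
      then have "expectation (\<lambda>w. g w + indicator A w) \<le> F b"
        unfolding F_def by (rule cSUP_upper[OF _ bdd])
      moreover have "expectation (\<lambda>w. g w + indicator A w) = expectation g + prob A"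
        using int[OF g] A by (subst Bochner_Integration.integral_add) (auto simp: emeasure_eq_measure)
      ultimately show ?thesis by simp
    qed
    then have "F a \<le> F b - prob A"
      unfolding F_def using zero by (intro cSUP_least) auto
    then show "F a + prob A \<le> F b" by simp
  qed
qed

text \<open>For a finite subset of \<open>J\<close>, a change of \<open>u\<close> forces
  \<open>h\<close> to grow by 1 between the least and the greatest point, so superadditivity of
  \<open>F\<close> bounds the probability by a difference of \<open>F\<close>. Finite subsets come
  first since \<open>J\<close> may lack extreme points; a countable \<open>J\<close> is their
  increasing union, and continuity from below preserves the bound.\<close>

lemma (in prob_space)
  fixes u :: "'t \<Rightarrow> real \<Rightarrow> 'a \<Rightarrow> real" and h :: "real \<Rightarrow> 'a \<Rightarrow> real"
  assumes T: "countable T" and J: "countable J"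
    and meas: "\<And>\<tau> a. \<tau> \<in> T \<Longrightarrow> a \<in> J \<Longrightarrow> u \<tau> a \<in> borel_measurable M"
  shows change_event_measurable:
      "{w \<in> space M. \<exists>\<tau>\<in>T. \<exists>a\<in>J. \<exists>b\<in>J. u \<tau> a w \<noteq> u \<tau> b w} \<in> events"
    and prob_change_le: "\<lbrakk>
      \<And>\<tau> a b w. w \<in> space M \<Longrightarrow> a \<le> b \<Longrightarrow> u \<tau> a w \<noteq> u \<tau> b w \<Longrightarrow> h a w + 1 \<le> h b w;
      \<And>a b w. a \<le> b \<Longrightarrow> h a w \<le> h b w;
      \<And>a b A. A \<in> events \<Longrightarrow> (\<And>w. w \<in> space M \<Longrightarrow> h a w + indicator A w \<le> h b w) \<Longrightarrow>
        F a + prob A \<le> F b;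
      \<And>a b. a \<in> J \<Longrightarrow> b \<in> J \<Longrightarrow> F b - F a \<le> \<eta>; 0 \<le> \<eta> \<rbrakk> \<Longrightarrow>
      prob {w \<in> space M. \<exists>\<tau>\<in>T. \<exists>a\<in>J. \<exists>b\<in>J. u \<tau> a w \<noteq> u \<tau> b w} \<le> \<eta>"
proof -
  define E where "E = (\<lambda>J'. {w \<in> space M. \<exists>\<tau>\<in>T. \<exists>a\<in>J'. \<exists>b\<in>J'. u \<tau> a w \<noteq> u \<tau> b w})"
  have E_meas: "E J' \<in> events" if J': "J' \<subseteq> J" for J'
  proof -
    have c: "countable J'" using J J' by (rule countable_subset[rotated])
    have "{w \<in> space M. u \<tau> a w \<noteq> u \<tau> b w} \<in> events" if "\<tau> \<in> T" "a \<in> J'" "b \<in> J'" for \<tau> a b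
    proof -
      have [measurable]: "u \<tau> a \<in> borel_measurable M" "u \<tau> b \<in> borel_measurable M"
        using meas that J' by auto
      show ?thesis by measurable
    qed
    then have "(\<Union>\<tau>\<in>T. \<Union>a\<in>J'. \<Union>b\<in>J'. {w \<in> space M. u \<tau> a w \<noteq> u \<tau> b w}) \<in> events"
      using T c by (intro sets.countable_UN'' )
    also have "(\<Union>\<tau>\<in>T. \<Union>a\<in>J'. \<Union>b\<in>J'. {w \<in> space M. u \<tau> a w \<noteq> u \<tau> b w}) = E J'"
      by (auto simp: E_def)
    finally show ?thesis .
  qed
  then show "{w \<in> space M. \<exists>\<tau>\<in>T. \<exists>a\<in>J. \<exists>b\<in>J. u \<tau> a w \<noteq> u \<tau> b w} \<in> events"
    by (simp add: E_def)
  assume step: "\<And>\<tau> a b w. w \<in> space M \<Longrightarrow> a \<le> b \<Longrightarrow> u \<tau> a w \<noteq> u \<tau> b w \<Longrightarrow> h a w + 1 \<le> h b w"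
    and mono: "\<And>a b w. a \<le> b \<Longrightarrow> h a w \<le> h b w"
    and F: "\<And>a b A. A \<in> events \<Longrightarrow> (\<And>w. w \<in> space M \<Longrightarrow> h a w + indicator A w \<le> h b w) \<Longrightarrow>
        F a + prob A \<le> F b"
    and diff: "\<And>a b. a \<in> J \<Longrightarrow> b \<in> J \<Longrightarrow> F b - F a \<le> \<eta>" and \<eta>: "0 \<le> \<eta>"
  have fin: "prob (E J') \<le> \<eta>" if J': "finite J'" "J' \<noteq> {}" "J' \<subseteq> J" for J'
  proof -
    define x y where "x = Min J'" and "y = Max J'"
    have "x \<in> J'" "y \<in> J'"
      unfolding x_def y_def using Min_in[OF J'(1,2)] Max_in[OF J'(1,2)] .
    then have xy: "x \<in> J" "y \<in> J" using J'(3) by blast+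
    have bounds: "x \<le> a \<and> a \<le> y" if "a \<in> J'" for a
      using that J'(1) by (simp add: x_def y_def)
    have "h x w + indicator (E J') w \<le> h y w" if w: "w \<in> space M" for w
    proof (cases "w \<in> E J'")
      case True
      then obtain \<tau> a b where ab: "a \<in> J'" "b \<in> J'" "u \<tau> a w \<noteq> u \<tau> b w" by (auto simp: E_def)
      have "\<exists>a\<in>J'. \<exists>b\<in>J'. h a w + 1 \<le> h b w"
        using step[OF w, of a b \<tau>] step[OF w, of b a \<tau>] ab by (cases "a \<le> b") auto
      then obtain a b where ab: "a \<in> J'" "b \<in> J'" "h a w + 1 \<le> h b w" by blast
      have "h x w \<le> h a w" "h b w \<le> h y w" using bounds ab mono by auto
      then show ?thesis using True ab by simp
    next
      case False
      have "x \<le> y" using bounds J'(2) by force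
      then show ?thesis using False mono by simp
    qed
    then have "F x + prob (E J') \<le> F y" by (rule F[OF E_meas[OF J'(3)]])
    then show ?thesis using diff[OF xy(1,2)] by simp
  qed
  have "prob (E J) \<le> \<eta>"
  proof (cases "J = {}")
    case True
    then show ?thesis using \<eta> by (simp add: E_def)
  next
    case False
    define e where "e = from_nat_into J"
    have e: "range e = J" using False J by (simp add: e_def range_from_nat_into)
    have sub: "e ` {..r} \<subseteq> J" for r using e by auto
    have inc: "incseq (\<lambda>r. E (e ` {..r}))"
    proof (rule incseq_SucI)
      fix r
      have "e ` {..r} \<subseteq> e ` {..Suc r}" by auto
      then show "E (e ` {..r}) \<subseteq> E (e ` {..Suc r})" unfolding E_def by blast
    qed
    have un: "(\<Union>r. E (e ` {..r})) = E J"
    proof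
      show "(\<Union>r. E (e ` {..r})) \<subseteq> E J" using sub unfolding E_def by blast
      show "E J \<subseteq> (\<Union>r. E (e ` {..r}))"
      proof
        fix w assume "w \<in> E J"
        then obtain \<tau> k l where *: "w \<in> space M" "\<tau> \<in> T" "u \<tau> (e k) w \<noteq> u \<tau> (e l) w"
          unfolding E_def e[symmetric] by blast
        have "k \<in> {..max k l}" "l \<in> {..max k l}" by auto
        then have "w \<in> E (e ` {..max k l})" using * unfolding E_def by blast
        then show "w \<in> (\<Union>r. E (e ` {..r}))" by blast
      qed
    qed
    have "(\<lambda>r. prob (E (e ` {..r}))) \<longlonglongrightarrow> prob (\<Union>r. E (e ` {..r}))"
      by (rule finite_Lim_measure_incseq[OF _ inc]) (use E_meas[OF sub] in auto)
    then show ?thesis unfolding un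
      by (rule LIMSEQ_le_const2) (use fin sub in auto)
  qed
  then show "prob {w \<in> space M. \<exists>\<tau>\<in>T. \<exists>a\<in>J. \<exists>b\<in>J. u \<tau> a w \<noteq> u \<tau> b w} \<le> \<eta>"
    by (simp add: E_def)
qed

text \<open>A countable subset of an interval that is dense for one-sided approximation from either
  side, as \<open>loss_eq_nearby\<close> prescribes the direction in which each coordinate may move.\<close>

definition interval_core :: "real set \<Rightarrow> real set" where
  "interval_core J = (J \<inter> \<rat>) \<union> {x \<in> J. \<forall>y\<in>J. y \<le> x} \<union> {x \<in> J. \<forall>y\<in>J. x \<le> y}"

lemma interval_core_subset: "interval_core J \<subseteq> J"
  by (auto simp: interval_core_def)

lemma countable_interval_core: "countable (interval_core J)"
proof -
  have subsingleton: "countable S" if "\<And>x y. x \<in> S \<Longrightarrow> y \<in> S \<Longrightarrow> x = y" for S :: "real set"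
  proof (cases "S = {}")
    case False
    then obtain z where "z \<in> S" by blast
    then have "S \<subseteq> {z}" using that by blast
    then show ?thesis by (rule countable_subset) simp
  qed simp
  have "countable {x \<in> J. \<forall>y\<in>J. y \<le> x}" "countable {x \<in> J. \<forall>y\<in>J. x \<le> y}"
    by (rule subsingleton, auto intro: antisym)+
  then show ?thesis
    unfolding interval_core_def using countable_rat by (auto intro: countable_subset[of _ \<rat>])
qed

text \<open>An extreme point of \<open>J\<close> approximates itself; otherwise \<open>J\<close>
  extends beyond \<open>x\<close> on the required side and contains a nearby rational there.\<close>

lemma interval_core_approx:
  assumes "is_interval J" "x \<in> J" "0 < r"
  shows "\<exists>y\<in>interval_core J. x \<le> y \<and> y < x + r" "\<exists>y\<in>interval_core J. x - r < y \<and> y \<le> x"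
proof -
  show "\<exists>y\<in>interval_core J. x \<le> y \<and> y < x + r"
  proof (cases "\<forall>y\<in>J. y \<le> x")
    case True
    then show ?thesis using assms by (intro bexI[of _ x]) (auto simp: interval_core_def)
  next
    case False
    then obtain z where z: "z \<in> J" "x < z" by force
    then obtain y where y: "y \<in> \<rat>" "x < y" "y < min z (x + r)"
      using Rats_dense_in_real[of x "min z (x + r)"] assms by auto
    then have "y \<in> J" using assms z unfolding is_interval_1 by (meson less_imp_le min_less_iff_conj)
    then show ?thesis using y by (intro bexI[of _ y]) (auto simp: interval_core_def)
  qed
  show "\<exists>y\<in>interval_core J. x - r < y \<and> y \<le> x"
  proof (cases "\<forall>y\<in>J. x \<le> y")
    case True
    then show ?thesis using assms by (intro bexI[of _ x]) (auto simp: interval_core_def)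
  next
    case False
    then obtain z where z: "z \<in> J" "z < x" by force
    then obtain y where y: "y \<in> \<rat>" "max z (x - r) < y" "y < x"
      using Rats_dense_in_real[of "max z (x - r)" x] assms by auto
    then have "y \<in> J" using assms z unfolding is_interval_1 by (meson less_imp_le max_less_iff_conj)
    then show ?thesis using y by (intro bexI[of _ y]) (auto simp: interval_core_def)
  qed
qed

section \<open>Boxes of subsidy vectors and cells of constant loss\<close>

definition subsidy_box :: "nat \<Rightarrow> (nat \<Rightarrow> real set) \<Rightarrow> (nat \<Rightarrow> real) set" where
  "subsidy_box n J = {\<sigma>. (\<forall>i<n. \<sigma> i \<in> J i) \<and> (\<forall>i\<ge>n. \<sigma> i = 0)}"

lemma countable_subsidy_box:
  assumes "\<And>i. i < n \<Longrightarrow> countable (J i)"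
  shows "countable (subsidy_box n J)"
proof -
  have "subsidy_box n J \<subseteq> (\<lambda>f i. if i < n then f i else 0) ` PiE {..<n} J"
  proof
    fix \<sigma> assume \<sigma>: "\<sigma> \<in> subsidy_box n J"
    then have "restrict \<sigma> {..<n} \<in> PiE {..<n} J" by (auto simp: subsidy_box_def)
    moreover have "\<sigma> = (\<lambda>i. if i < n then restrict \<sigma> {..<n} i else 0)"
      using \<sigma> by (auto simp: subsidy_box_def fun_eq_iff)
    ultimately show "\<sigma> \<in> (\<lambda>f i. if i < n then f i else 0) ` PiE {..<n} J" by blast
  qed
  moreover have "countable (PiE {..<n} J)" using assms by (intro countable_PiE) auto
  ultimately show ?thesis using countable_subset countable_image by metis
qed

text \<open>The direction and radius supplied by \<open>loss_eq_nearby\<close> depend on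
  \<open>G\<close>, but the core does not: one countable family of vectors serves all games.\<close>

lemma loss_value_on_core:
  assumes J: "\<And>i. i < n \<Longrightarrow> is_interval (J i)" and \<sigma>: "\<sigma> \<in> subsidy_box n J"
  shows "\<exists>\<sigma>' \<in> subsidy_box n (\<lambda>i. interval_core (J i)). loss n G \<sigma>' = loss n G \<sigma>"
proof (rule loss_eq_nearby[where n=n and G=G and \<sigma>=\<sigma>])
  fix s r
  assume r: "0 < r" and near: "\<And>\<sigma>'. (\<And>i. i < n \<Longrightarrow> \<bar>\<sigma>' i - \<sigma> i\<bar> < r) \<Longrightarrow>
       (\<And>i. i < n \<Longrightarrow> if s i then \<sigma> i \<le> \<sigma>' i else \<sigma>' i \<le> \<sigma> i) \<Longrightarrow> loss n G \<sigma>' = loss n G \<sigma>"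
  have "\<exists>y. y \<in> interval_core (J i) \<and> \<bar>y - \<sigma> i\<bar> < r \<and> (if s i then \<sigma> i \<le> y else y \<le> \<sigma> i)" if i: "i < n" for i
  proof -
    have "\<sigma> i \<in> J i" using \<sigma> i by (auto simp: subsidy_box_def)
    note approx = interval_core_approx[OF J[OF i] this r]
    show ?thesis
    proof (cases "s i")
      case True
      then show ?thesis using approx(1) by (auto simp: abs_less_iff)
    next
      case False
      then show ?thesis using approx(2) by (auto simp: abs_less_iff)
    qed
  qed
  then obtain y where y: "\<And>i. i < n \<Longrightarrow> y i \<in> interval_core (J i)" "\<And>i. i < n \<Longrightarrow> \<bar>y i - \<sigma> i\<bar> < r"
    "\<And>i. i < n \<Longrightarrow> if s i then \<sigma> i \<le> y i else y i \<le> \<sigma> i"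
    by metis
  show ?thesis
  proof (rule bexI)
    let ?y = "\<lambda>i. if i < n then y i else 0"
    show "loss n G ?y = loss n G \<sigma>" by (rule near) (use y in auto)
    show "?y \<in> subsidy_box n (\<lambda>i. interval_core (J i))" using y by (auto simp: subsidy_box_def)
  qed
qed

text \<open>Each axis is cut where the lower integral of the threshold count passes a multiple of
  \<open>q / n\<close>. Moving inside a piece then changes the loss with probability at most
  \<open>q / n\<close>, and the \<open>n\<close> axes together contribute \<open>q\<close>.\<close>

lemma subsidy_cells:
  fixes D :: "cm_game measure"
  assumes "prob_space D" and n: "1 \<le> n" and q: "0 < q"
    and meas: "\<And>\<sigma>. \<sigma> \<in> subsidies n H \<Longrightarrow> (\<lambda>G. loss n G \<sigma>) \<in> borel_measurable D"
  shows "\<exists>(\<kappa> :: (nat \<Rightarrow> real) \<Rightarrow> nat \<Rightarrow> nat) E. finite (\<kappa> ` subsidies n H)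
    \<and> real (card (\<kappa> ` subsidies n H)) \<le> (real n * 2 ^ (n + 1) / q + 1) ^ n
    \<and> (\<forall>c. E c \<in> sets D \<and> measure D (E c) \<le> q)
    \<and> (\<forall>\<sigma>\<in>subsidies n H. \<forall>\<sigma>'\<in>subsidies n H. \<forall>G\<in>space D - E (\<kappa> \<sigma>).
         \<kappa> \<sigma> = \<kappa> \<sigma>' \<longrightarrow> loss n G \<sigma> = loss n G \<sigma>')"
proof -
  interpret prob_space D by fact
  have "\<exists>F. (\<forall>x. 0 \<le> F x \<and> F x \<le> 2 ^ (n + 1)) \<and> (\<forall>a b A. A \<in> events \<longrightarrow>
     (\<forall>G\<in>space D. below_count n G i a + indicator A G \<le> below_count n G i b) \<longrightarrow> F a + prob A \<le> F b)" for i
  proof (rule lower_integral_superadditive[of "\<lambda>x G. below_count n G i x" "2 ^ (n + 1)"])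
    show "0 \<le> below_count n G i x \<and> below_count n G i x \<le> 2 ^ (n + 1)" for x G
      using below_count_nonneg below_count_le by simp
    fix F
    assume "\<And>x. 0 \<le> F x" "\<And>x. F x \<le> 2 ^ (n + 1)" "\<And>a b A. A \<in> events \<Longrightarrow>
       (\<And>G. G \<in> space D \<Longrightarrow> below_count n G i a + indicator A G \<le> below_count n G i b) \<Longrightarrow>
       F a + prob A \<le> F b"
    then show ?thesis by (intro exI[of _ F]) blast
  qed
  then obtain F where F: "\<And>i x. 0 \<le> F i x" "\<And>i x. F i x \<le> 2 ^ (n + 1)"
    and F_super: "\<And>i a b A. A \<in> events \<Longrightarrow>
       (\<And>G. G \<in> space D \<Longrightarrow> below_count n G i a + indicator A G \<le> below_count n G i b) \<Longrightarrow> F i a + prob A \<le> F i b"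
    by metis
  have F_mono: "F i a \<le> F i b" if "a \<le> b" for i a b
    using F_super[of "{}" i a b] below_count_mono[OF that] by simp
  define \<eta> where "\<eta> = q / real n"
  have \<eta>: "0 < \<eta>" using q n by (simp add: \<eta>_def)
  define level where "level = (\<lambda>i x. nat \<lfloor>F i x / \<eta>\<rfloor>)"
  define \<kappa> where "\<kappa> = (\<lambda>\<sigma>. restrict (\<lambda>i. level i (\<sigma> i)) {..<n})"
  define J where "J = (\<lambda>c i. {x \<in> {0..H}. level i x = c i})"
  define J' where "J' = (\<lambda>c i. interval_core (J c i))"
  define T where "T = (\<lambda>c. subsidy_box n (J' c))"
  define Ei where "Ei = (\<lambda>c i. {G \<in> space D. \<exists>\<tau>\<in>T c. \<exists>a\<in>J' c i. \<exists>b\<in>J' c i.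
     loss n G (\<tau>(i := a)) \<noteq> loss n G (\<tau>(i := b))})"
  define E where "E = (\<lambda>c. \<Union>i<n. Ei c i)"

  have level_mono: "level i a \<le> level i b" if "a \<le> b" for i a b
    unfolding level_def using F_mono[OF that] \<eta> by (intro nat_mono floor_mono divide_right_mono) auto
  \<comment> \<open>Level sets of a monotone function are intervals.\<close>
  have interval: "is_interval (J c i)" for c i
    unfolding is_interval_1 J_def by (auto intro: antisym level_mono dest: level_mono) 
       (metis antisym level_mono)
  have J'_sub: "J' c i \<subseteq> J c i" for c i unfolding J'_def by (rule interval_core_subset)
  have T_sub: "\<tau>(i := a) \<in> subsidies n H" if "\<tau> \<in> T c" "a \<in> J' c i" "i < n" for \<tau> a c i
  proof -
    have range: "0 \<le> x \<and> x \<le> H" if "x \<in> J' c j" for x j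
      using subsetD[OF J'_sub that] by (simp add: J_def)
    show ?thesis
      using that range[of "\<tau> _"] range[of a i] unfolding T_def subsidy_box_def subsidies_def
      by (simp, blast)
  qed
  have T_count: "countable (T c)" and J'_count: "countable (J' c i)" for c i
    unfolding T_def J'_def by (auto intro!: countable_subsidy_box countable_interval_core)
  have F_diff: "F i b - F i a \<le> \<eta>" if "a \<in> J' c i" "b \<in> J' c i" for a b c i
  proof -
    have "nat \<lfloor>F i a / \<eta>\<rfloor> = nat \<lfloor>F i b / \<eta>\<rfloor>"
      using that[THEN subsetD[OF J'_sub]] by (simp add: J_def level_def)
    \<comment> \<open>Truncation by \<open>nat\<close> loses nothing since \<open>F\<close> is
      nonnegative; numbers with equal floor differ by less than 1.\<close>
    then have "\<lfloor>F i a / \<eta>\<rfloor> = \<lfloor>F i b / \<eta>\<rfloor>"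
      using F(1) \<eta> by (metis divide_nonneg_pos eq_nat_nat_iff zero_le_floor)
    then have "F i b / \<eta> - F i a / \<eta> \<le> 1" by linarith
    then show ?thesis using \<eta> by (simp add: field_simps)
  qed
  have Ei_meas: "Ei c i \<in> events" if "i < n" for c i
    unfolding Ei_def
    by (rule change_event_measurable[where u = "\<lambda>\<tau> a G. loss n G (\<tau>(i := a))"])
       (use T_count J'_count meas T_sub that in auto)
  have Ei_prob: "prob (Ei c i) \<le> \<eta>" if "i < n" for c i
    unfolding Ei_def
    by (rule prob_change_le[where u = "\<lambda>\<tau> a G. loss n G (\<tau>(i := a))"
          and h = "\<lambda>x G. below_count n G i x" and F = "F i"])
       (use T_count J'_count meas T_sub that below_count_ge_of_loss_change below_count_mono
          F_super F_diff \<eta> in auto)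
  have E: "E c \<in> events" "prob (E c) \<le> q" for c
  proof -
    show "E c \<in> events" unfolding E_def using Ei_meas by auto
    have "prob (E c) \<le> (\<Sum>i<n. prob (Ei c i))"
      unfolding E_def by (rule measure_UNION_le) (use Ei_meas in auto)
    also have "\<dots> \<le> (\<Sum>i<n. \<eta>)" by (rule sum_mono) (use Ei_prob in auto)
    also have "\<dots> = q" using n by (simp add: \<eta>_def)
    finally show "prob (E c) \<le> q" .
  qed
  have const_core: "loss n G \<sigma> = loss n G \<sigma>'"
    if G: "G \<in> space D - E c" and \<sigma>: "\<sigma> \<in> T c" "\<sigma>' \<in> T c" for G \<sigma> \<sigma>' c
  proof -
    \<comment> \<open>The coordinates are exchanged one at a time. Every intermediate vector stays
      in \<open>T c\<close>, so each exchange is covered by one of the events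
      \<open>Ei\<close>.\<close>
    define \<tau> where "\<tau> = (\<lambda>k i. if i < k then \<sigma>' i else \<sigma> i)"
    have "loss n G (\<tau> k) = loss n G \<sigma>" if "k \<le> n" for k
      using that
    proof (induction k)
      case 0
      then show ?case by (simp add: \<tau>_def)
    next
      case (Suc k)
      have 1: "\<tau> (Suc k) = (\<tau> k)(k := \<sigma>' k)" "\<tau> k = (\<tau> k)(k := \<sigma> k)"
        by (auto simp: \<tau>_def fun_eq_iff)
      have "\<tau> k \<in> T c" "\<sigma> k \<in> J' c k" "\<sigma>' k \<in> J' c k"
        using \<sigma> Suc.prems by (auto simp: \<tau>_def T_def subsidy_box_def)
      moreover have "G \<notin> Ei c k" "G \<in> space D" using G Suc.prems by (auto simp: E_def)
      ultimately have "loss n G ((\<tau> k)(k := \<sigma>' k)) = loss n G ((\<tau> k)(k := \<sigma> k))"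
        unfolding Ei_def by blast
      then show ?case using 1 Suc by (metis Suc_leD)
    qed
    moreover have "\<tau> n = \<sigma>'"
      using \<sigma> by (auto simp: \<tau>_def T_def subsidy_box_def fun_eq_iff not_less)
    ultimately show ?thesis by (metis order_refl)
  qed
  have box: "\<sigma> \<in> subsidy_box n (J (\<kappa> \<sigma>))" if "\<sigma> \<in> subsidies n H" for \<sigma>
    using that by (auto simp: subsidies_def subsidy_box_def J_def \<kappa>_def)
  have const: "loss n G \<sigma> = loss n G \<sigma>'"
    if *: "\<sigma> \<in> subsidies n H" "\<sigma>' \<in> subsidies n H" "G \<in> space D - E (\<kappa> \<sigma>)" "\<kappa> \<sigma> = \<kappa> \<sigma>'" for G \<sigma> \<sigma>'
  proof -
    \<comment> \<open>These core points may vary with \<open>G\<close>; this is harmless because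
      \<open>E\<close> already ranges over the whole core.\<close>
    obtain \<tau> \<tau>' where "\<tau> \<in> T (\<kappa> \<sigma>)" "loss n G \<tau> = loss n G \<sigma>" "\<tau>' \<in> T (\<kappa> \<sigma>)" "loss n G \<tau>' = loss n G \<sigma>'"
      using loss_value_on_core[OF interval box[OF *(1)], of G]
        loss_value_on_core[OF interval box[OF *(2)], of G] *(4)
      unfolding T_def J'_def by auto
    then show ?thesis using const_core[OF *(3)] by metis
  qed
  define N where "N = nat \<lfloor>2 ^ (n + 1) / \<eta>\<rfloor>"
  have sub: "\<kappa> ` subsidies n H \<subseteq> PiE {..<n} (\<lambda>_. {..N})"
  proof (rule image_subsetI)
    fix \<sigma>
    have "level i x \<le> N" for i x
      unfolding level_def N_def using F(2) \<eta> by (intro nat_mono floor_mono divide_right_mono) auto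
    then show "\<kappa> \<sigma> \<in> PiE {..<n} (\<lambda>_. {..N})" by (simp add: \<kappa>_def restrict_PiE_iff)
  qed
  have fin: "finite (PiE {..<n} (\<lambda>_. {..N}))" by (intro finite_PiE) auto
  have "card (\<kappa> ` subsidies n H) \<le> Suc N ^ n"
    using card_mono[OF fin sub] by (simp add: card_PiE)
  then have "real (card (\<kappa> ` subsidies n H)) \<le> (real N + 1) ^ n"
    by (metis of_nat_Suc of_nat_le_iff of_nat_power add.commute)
  also have "\<dots> \<le> (real n * 2 ^ (n + 1) / q + 1) ^ n"
  proof (rule power_mono)
    have "real N \<le> 2 ^ (n + 1) / \<eta>" using \<eta> by (simp add: N_def)
    also have "\<dots> = real n * 2 ^ (n + 1) / q" using n q by (simp add: \<eta>_def)
    finally show "real N + 1 \<le> real n * 2 ^ (n + 1) / q + 1" by simp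
  qed simp
  finally have "real (card (\<kappa> ` subsidies n H)) \<le> (real n * 2 ^ (n + 1) / q + 1) ^ n" .
  moreover have "finite (\<kappa> ` subsidies n H)" using fin sub by (rule finite_subset[rotated])
  ultimately show ?thesis using E const by blast
qed

section \<open>Empirical risk minimisation\<close>

text \<open>One factor \<open>n\<close> in the exponent comes from the \<open>2 ^ n\<close>
  thresholds per axis, the other from the \<open>n\<close> axes. This gives
  \<open>V = 4 * n^2\<close> in the chaining bound.\<close>

lemma cell_count_le_exp:
  assumes "1 \<le> n"
  shows "(real n * 2 ^ (n + 1) / (1/2) ^ k + 1) ^ n \<le> exp (4 * (real n)\<^sup>2 * (real k + 1))"
proof -
  have "real n * 2 ^ (n + 1) / (1/2) ^ k = real n * 2 ^ (n + 1 + k)"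
    by (simp add: power_add power_one_over)
  also have "\<dots> + 1 \<le> 2 ^ n * 2 ^ (n + 1 + k) + 2 ^ n * 2 ^ (n + 1 + k)"
  proof (rule add_mono)
    have "real n \<le> 2 ^ n" using of_nat_mono[OF less_imp_le[OF less_exp[of n]], where 'a=real] by simp
    then show "real n * 2 ^ (n + 1 + k) \<le> 2 ^ n * 2 ^ (n + 1 + k)" by (rule mult_right_mono) simp
    show "(1::real) \<le> 2 ^ n * 2 ^ (n + 1 + k)" by (simp add: power_add[symmetric] del: power_Suc)
  qed
  also have "\<dots> = 2 ^ (2 * n + 2 + k)"
  proof -
    have "2 * n + 2 + k = Suc (n + (n + 1 + k))" by simp
    then show ?thesis by (simp only: power_Suc power_add mult_2)
  qed
  also have "\<dots> \<le> exp 1 ^ (2 * n + 2 + k)"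
    using exp_ge_add_one_self[of "1::real"] by (intro power_mono) auto
  also have "\<dots> = exp (real (2 * n + 2 + k))"
    by (metis exp_of_nat_mult mult.right_neutral)
  also have "\<dots> \<le> exp (4 * real n * (real k + 1))"
  proof -
    have "k \<le> n * k" using assms by simp
    moreover have "4 * n * (k + 1) = 4 * (n * k) + 4 * n" by (simp add: algebra_simps)
    ultimately have "2 * n + 2 + k \<le> 4 * n * (k + 1)" using assms by linarith
    then have "real (2 * n + 2 + k) \<le> real (4 * n * (k + 1))" by (simp only: of_nat_le_iff)
    then show ?thesis by (simp add: algebra_simps)
  qed
  finally have "(real n * 2 ^ (n + 1) / (1/2) ^ k + 1) ^ n \<le> exp (4 * real n * (real k + 1)) ^ n"
    by (rule power_mono) simp
  also have "\<dots> = exp (4 * (real n)\<^sup>2 * (real k + 1))"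
    by (simp add: exp_of_nat_mult[symmetric] power2_eq_square mult_ac)
  finally show ?thesis .
qed

text \<open>After scaling the losses to \<open>[0, 1]\<close>, a uniform bound is needed only from
  expectation to empirical mean, as the minimiser depends on the sample. The comparison vector is
  fixed, so its reverse deviation concerns a single function. The errors are
  \<open>\<epsilon> / 2\<close>, \<open>\<epsilon> / 8\<close> and another
  \<open>\<epsilon> / 8\<close> for near-optimality.\<close>

lemma erm_subsidy_guarantee:
  fixes D :: "cm_game measure"
  assumes "prob_space D" and n: "1 \<le> n" and H: "1 \<le> H"
    and valid: "\<And>G. G \<in> space D \<Longrightarrow> valid_game n H G"
    and meas: "\<And>\<sigma>. \<sigma> \<in> subsidies n H \<Longrightarrow> (\<lambda>G. loss n G \<sigma>) \<in> borel_measurable D"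
    and \<epsilon>: "0 < \<epsilon>" "\<epsilon> \<le> 2 * real n * H" and \<delta>: "0 < \<delta>" "\<delta> < 1"
    and m: "real m \<ge> 2 ^ 23 * ((real n)\<^sup>2 * H\<^sup>2 / \<epsilon>\<^sup>2) * ((real n)\<^sup>2 + ln (1 / \<delta>))"
  obtains A where "A \<in> sets (PiM {..<m} (\<lambda>_. D))" "measure (PiM {..<m} (\<lambda>_. D)) A \<le> \<delta>"
    "\<And>S \<sigma>h. S \<in> space (PiM {..<m} (\<lambda>_. D)) - A \<Longrightarrow> is_ERM n H m S \<sigma>h \<Longrightarrow>
       exp_loss n D \<sigma>h \<le> (INF \<sigma>\<in>subsidies n H. exp_loss n D \<sigma>) + \<epsilon>"
proof -
  interpret prob_space D by fact
  let ?P = "PiM {..<m} (\<lambda>_. D)"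
  define B where "B = 2 * real n * H"
  have B: "0 < B" using n H by (simp add: B_def)
  define g where "g = (\<lambda>\<sigma> G. loss n G \<sigma> / B)"
  define \<epsilon>' where "\<epsilon>' = \<epsilon> / B"
  have \<epsilon>': "0 < \<epsilon>'" "\<epsilon>' \<le> 1" "\<epsilon> = B * \<epsilon>'"
    using \<epsilon> B unfolding \<epsilon>'_def B_def[symmetric] by auto
  have g_meas: "g \<sigma> \<in> borel_measurable D" if "\<sigma> \<in> subsidies n H" for \<sigma>
    unfolding g_def using meas[OF that] by (intro borel_measurable_divide) auto
  have g_range: "0 \<le> g \<sigma> G \<and> g \<sigma> G \<le> 1" if "G \<in> space D" for \<sigma> G
    using loss_bounds[OF valid[OF that] H, of \<sigma>] B by (simp add: g_def B_def)
  have exp_g: "exp_loss n D \<sigma> = B * expectation (g \<sigma>)" for \<sigma>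
    using B by (simp add: exp_loss_def g_def)
  have emp_g: "avg_loss n m S \<sigma> = B * emp_mean m S (g \<sigma>)" for S \<sigma>
    using B by (simp add: avg_loss_def emp_mean_def g_def sum_divide_distrib[symmetric])

  define L where "L = ln (1 / \<delta>)"
  have L: "0 < L" "ln \<delta> = - L" using \<delta> by (auto simp: L_def ln_div)
  have n2: "1 \<le> (real n)\<^sup>2" using n by simp
  have lnhalf: "ln (1 / (\<delta> / 2)) = L + ln 2" "ln (\<delta> / 2) = - L - ln 2" "ln 2 \<le> (1::real)"
    using \<delta> L ln_le_minus_one[of 2] by (auto simp: ln_div ln_mult)
  \<comment> \<open>Scaling by \<open>B = 2 * n * H\<close> turns \<open>2 ^ 23\<close> into
    \<open>2 ^ 21\<close>, which is \<open>8 * 2 ^ 18\<close>; the factor 8 absorbs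
    \<open>4 * n^2\<close> and the \<open>ln 2\<close> from halving \<open>\<delta>\<close>.\<close>
  have m': "2 ^ 18 * (4 * (real n)\<^sup>2 + ln (1 / (\<delta> / 2))) \<le> real m * \<epsilon>'\<^sup>2"
  proof -
    have "2 ^ 23 * ((real n)\<^sup>2 * H\<^sup>2 / \<epsilon>\<^sup>2) * ((real n)\<^sup>2 + L) * \<epsilon>'\<^sup>2 \<le> real m * \<epsilon>'\<^sup>2"
      using m by (intro mult_right_mono) (auto simp: L_def)
    also have "2 ^ 23 * ((real n)\<^sup>2 * H\<^sup>2 / \<epsilon>\<^sup>2) * ((real n)\<^sup>2 + L) * \<epsilon>'\<^sup>2
        = 2 ^ 21 * ((real n)\<^sup>2 + L)"
      using \<epsilon> B n H by (simp add: \<epsilon>'_def B_def field_simps power_mult_distrib)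
    finally have "2 ^ 21 * ((real n)\<^sup>2 + L) \<le> real m * \<epsilon>'\<^sup>2" .
    moreover have "2 ^ 18 * (4 * (real n)\<^sup>2 + (L + ln 2)) \<le> 2 ^ 21 * ((real n)\<^sup>2 + L)"
      using n2 L lnhalf(3) by simp
    ultimately show ?thesis unfolding lnhalf by linarith
  qed
  define h where "h = 4 * (real n)\<^sup>2 + (L + ln 2)"
  have h: "0 < h" "L + ln 2 \<le> h"
    unfolding h_def using n L by (auto intro!: add_pos_pos)
  have mh: "262144 * h \<le> real m * \<epsilon>'\<^sup>2"
    using m' unfolding lnhalf h_def by simp
  have "0 < real m * \<epsilon>'\<^sup>2" using mh h by linarith
  then have m0: "0 < m" by (cases "m = 0") auto

  have "\<forall>k. \<exists>(\<kappa> :: (nat \<Rightarrow> real) \<Rightarrow> nat \<Rightarrow> nat) E. finite (\<kappa> ` subsidies n H)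
    \<and> real (card (\<kappa> ` subsidies n H)) \<le> (real n * 2 ^ (n + 1) / (1/2) ^ k + 1) ^ n
    \<and> (\<forall>c. E c \<in> events \<and> prob (E c) \<le> (1/2) ^ k)
    \<and> (\<forall>\<sigma>\<in>subsidies n H. \<forall>\<sigma>'\<in>subsidies n H. \<forall>G\<in>space D - E (\<kappa> \<sigma>).
         \<kappa> \<sigma> = \<kappa> \<sigma>' \<longrightarrow> loss n G \<sigma> = loss n G \<sigma>')"
    by (intro allI subsidy_cells n meas prob_space_axioms) auto
  from choice[OF this] obtain \<kappa> :: "nat \<Rightarrow> (nat \<Rightarrow> real) \<Rightarrow> nat \<Rightarrow> nat"
    where "\<forall>k. \<exists>E. finite (\<kappa> k ` subsidies n H)
    \<and> real (card (\<kappa> k ` subsidies n H)) \<le> (real n * 2 ^ (n + 1) / (1/2) ^ k + 1) ^ n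
    \<and> (\<forall>c. E c \<in> events \<and> prob (E c) \<le> (1/2) ^ k)
    \<and> (\<forall>\<sigma>\<in>subsidies n H. \<forall>\<sigma>'\<in>subsidies n H. \<forall>G\<in>space D - E (\<kappa> k \<sigma>).
         \<kappa> k \<sigma> = \<kappa> k \<sigma>' \<longrightarrow> loss n G \<sigma> = loss n G \<sigma>')" ..
  from choice[OF this] obtain E where cells: "\<And>k. finite (\<kappa> k ` subsidies n H)"
    "\<And>k. real (card (\<kappa> k ` subsidies n H)) \<le> (real n * 2 ^ (n + 1) / (1/2) ^ k + 1) ^ n"
    "\<And>k c. E k c \<in> events" "\<And>k c. prob (E k c) \<le> (1/2) ^ k"
    "\<And>k \<sigma> \<sigma>' G. \<sigma> \<in> subsidies n H \<Longrightarrow> \<sigma>' \<in> subsidies n H \<Longrightarrow> \<kappa> k \<sigma> = \<kappa> k \<sigma>' \<Longrightarrow>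
       G \<in> space D - E k (\<kappa> k \<sigma>) \<Longrightarrow> loss n G \<sigma> = loss n G \<sigma>'"
    by blast
  obtain A1 where A1: "A1 \<in> sets ?P" "measure ?P A1 \<le> \<delta> / 2"
    and A1_good: "\<And>S \<sigma>. S \<in> space ?P - A1 \<Longrightarrow> \<sigma> \<in> subsidies n H \<Longrightarrow>
       expectation (g \<sigma>) \<le> emp_mean m S (g \<sigma>) + \<epsilon>' / 2"
  proof (rule uniform_deviation_chaining[of "subsidies n H" g \<kappa> "4 * (real n)\<^sup>2" E \<epsilon>' "\<delta> / 2" m])
    show "real (card (\<kappa> k ` subsidies n H)) \<le> exp (4 * (real n)\<^sup>2 * (real k + 1))" for k
      using cells(2)[of k] cell_count_le_exp[OF n, of k] by linarith
    show "g \<sigma> G = g \<sigma>' G" if "\<sigma> \<in> subsidies n H" "\<sigma>' \<in> subsidies n H" "\<kappa> k \<sigma> = \<kappa> k \<sigma>'"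
      "G \<in> space D - E k (\<kappa> k \<sigma>)" for k \<sigma> \<sigma>' G
      using cells(5)[OF that] by (simp add: g_def)
  qed (use g_meas g_range cells(1,3,4) \<epsilon>' \<delta> n2 m' in auto)

  have ne: "(\<lambda>_. 0) \<in> subsidies n H" using H by (simp add: subsidies_def)
  have bdd: "bdd_below (exp_loss n D ` subsidies n H)"
  proof (rule bdd_belowI2[where m=0])
    fix \<sigma> show "0 \<le> exp_loss n D \<sigma>"
      unfolding exp_g using B g_range by (intro mult_nonneg_nonneg integral_nonneg_AE) auto
  qed
  define opt where "opt = (INF \<sigma>\<in>subsidies n H. exp_loss n D \<sigma>)"
  \<comment> \<open>A near-minimiser suffices, so attainment of the infimum is not at issue.\<close>
  obtain \<sigma>o where \<sigma>o: "\<sigma>o \<in> subsidies n H" "exp_loss n D \<sigma>o < opt + \<epsilon> / 8"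
    using cINF_less_iff[OF _ bdd, of "opt + \<epsilon> / 8"] ne \<epsilon> by (auto simp: opt_def)
  obtain A2 where A2: "A2 \<in> sets ?P" "measure ?P A2 \<le> \<delta> / 2"
    and A2_good: "\<And>S X. S \<in> space ?P - A2 \<Longrightarrow> X \<in> {\<lambda>G. - g \<sigma>o G} \<Longrightarrow>
       expectation X \<le> emp_mean m S X + \<epsilon>' / 8"
  proof (rule emp_mean_uniform_tail[of "{\<lambda>G. - g \<sigma>o G}" 1 "\<epsilon>' / 8" m 0 "\<delta> / 2"])
    show "0 - real m * (\<epsilon>' / 8)\<^sup>2 / (4 * 1) \<le> ln (\<delta> / 2)"
    proof -
      have "real m * (\<epsilon>' / 8)\<^sup>2 / (4 * 1) = real m * \<epsilon>'\<^sup>2 / 256" by (simp add: power2_eq_square)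
      moreover have "L + ln 2 \<le> real m * \<epsilon>'\<^sup>2 / 256"
        using mh h by linarith
      ultimately show ?thesis unfolding lnhalf by linarith
    qed
  qed (use g_meas[OF \<sigma>o(1)] g_range \<epsilon>' \<delta> m0 in auto)
  show thesis
  proof
    show "A1 \<union> A2 \<in> sets ?P" using A1 A2 by auto
    show "measure ?P (A1 \<union> A2) \<le> \<delta>"
      using measure_Un_le[OF A1(1) A2(1)] A1(2) A2(2) by simp
    fix S \<sigma>h assume S: "S \<in> space ?P - (A1 \<union> A2)" and erm: "is_ERM n H m S \<sigma>h"
    have "\<sigma>h \<in> subsidies n H" and "avg_loss n m S \<sigma>h \<le> avg_loss n m S \<sigma>o"
      using erm \<sigma>o(1) by (auto simp: is_ERM_def)
    then have "expectation (g \<sigma>h) \<le> emp_mean m S (g \<sigma>h) + \<epsilon>' / 2"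
      and "emp_mean m S (g \<sigma>h) \<le> emp_mean m S (g \<sigma>o)"
      using A1_good[of S \<sigma>h] S B by (auto simp: emp_g)
    moreover have "emp_mean m S (g \<sigma>o) \<le> expectation (g \<sigma>o) + \<epsilon>' / 8"
      using A2_good[of S] S by (auto simp: emp_mean_minus)
    ultimately have "expectation (g \<sigma>h) \<le> expectation (g \<sigma>o) + 5 / 8 * \<epsilon>'" by linarith
    then have "B * expectation (g \<sigma>h) \<le> B * (expectation (g \<sigma>o) + 5 / 8 * \<epsilon>')"
      using B by (intro mult_left_mono) auto
    then have "exp_loss n D \<sigma>h \<le> exp_loss n D \<sigma>o + 5 / 8 * \<epsilon>"
      by (simp add: exp_g \<epsilon>'(3) algebra_simps)
    then have "exp_loss n D \<sigma>h \<le> opt + \<epsilon>" using \<sigma>o(2) \<epsilon> by linarith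
    then show "exp_loss n D \<sigma>h \<le> (INF \<sigma>\<in>subsidies n H. exp_loss n D \<sigma>) + \<epsilon>" by (simp add: opt_def)
  qed
qed

text \<open>The set of samples on which every empirical minimiser succeeds is not claimed to be
  measurable, so its size is expressed through a measurable subset \<open>A\<close>.\<close>

theorem theorem10:
  "\<exists>c::real. c > 0 \<and>
    (\<forall>(n::nat) (H::real) (\<epsilon>::real) (\<delta>::real) (D::cm_game measure) (m::nat).
      H \<ge> 1 \<longrightarrow> \<epsilon> > 0 \<longrightarrow> \<delta> > 0 \<longrightarrow>
      prob_space D \<longrightarrow>
      (\<forall>G\<in>space D. valid_game n H G) \<longrightarrow>
      (\<forall>\<sigma>\<in>subsidies n H. (\<lambda>G. loss n G \<sigma>) \<in> borel_measurable D) \<longrightarrow>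
      real m \<ge> c * (real n ^ 2 * H ^ 2 / \<epsilon> ^ 2) * (real n ^ 2 + ln (1 / \<delta>)) \<longrightarrow>
      (\<exists>A \<in> sets (PiM {..<m} (\<lambda>_. D)).
         A \<subseteq> {S \<in> space (PiM {..<m} (\<lambda>_. D)).
                \<forall>\<sigma>h. is_ERM n H m S \<sigma>h \<longrightarrow>
                   exp_loss n D \<sigma>h \<le> (INF \<sigma>\<in>subsidies n H. exp_loss n D \<sigma>) + \<epsilon>}
         \<and> measure (PiM {..<m} (\<lambda>_. D)) A \<ge> 1 - \<delta>))"
proof (intro exI[of _ "2 ^ 23"] conjI allI impI)
  fix n H \<epsilon> \<delta> m and D :: "cm_game measure"
  assume H: "H \<ge> 1" and \<epsilon>: "\<epsilon> > 0" and \<delta>: "\<delta> > 0" and D: "prob_space D"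
    and valid: "\<forall>G\<in>space D. valid_game n H G"
    and meas: "\<forall>\<sigma>\<in>subsidies n H. (\<lambda>G. loss n G \<sigma>) \<in> borel_measurable D"
    and m: "real m \<ge> 2 ^ 23 * (real n ^ 2 * H ^ 2 / \<epsilon> ^ 2) * (real n ^ 2 + ln (1 / \<delta>))"
  let ?P = "PiM {..<m} (\<lambda>_. D)"
  let ?good = "{S \<in> space ?P. \<forall>\<sigma>h. is_ERM n H m S \<sigma>h \<longrightarrow>
     exp_loss n D \<sigma>h \<le> (INF \<sigma>\<in>subsidies n H. exp_loss n D \<sigma>) + \<epsilon>}"
  interpret prob_space D by fact
  interpret P: prob_space ?P by (rule prob_space_PiM) (rule D)
  \<comment> \<open>For \<open>\<delta> \<ge> 1\<close> the empty event suffices. For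
    \<open>\<epsilon> > 2 * n * H\<close> any two expected losses differ by less than
    \<open>\<epsilon>\<close>; this case includes \<open>n = 0\<close>.\<close>
  consider "\<delta> \<ge> 1" | "\<epsilon> > 2 * real n * H" | "1 \<le> n" "\<epsilon> \<le> 2 * real n * H" "\<delta> < 1"
    using \<epsilon> by (cases "n = 0") force+
  then show "\<exists>A\<in>sets ?P. A \<subseteq> ?good \<and> measure ?P A \<ge> 1 - \<delta>"
  proof cases
    case 1
    then show ?thesis by (intro bexI[of _ "{}"]) auto
  next
    case 2
    have bounds: "0 \<le> exp_loss n D \<sigma> \<and> exp_loss n D \<sigma> \<le> 2 * real n * H" if "\<sigma> \<in> subsidies n H" for \<sigma>
    proof -
      have b: "0 \<le> loss n G \<sigma> \<and> loss n G \<sigma> \<le> 2 * real n * H" if "G \<in> space D" for G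
        using loss_bounds[of n H G \<sigma>] valid that H by auto
      then have "integrable D (\<lambda>G. loss n G \<sigma>)"
        using meas that by (intro integrable_const_bound[where B="2 * real n * H"]) auto
      then show ?thesis
        unfolding exp_loss_def using b by (intro conjI integral_nonneg_AE integral_le_const) auto
    qed
    have "0 \<le> (INF \<sigma>\<in>subsidies n H. exp_loss n D \<sigma>)"
    proof (rule cINF_greatest)
      have "(\<lambda>_. 0) \<in> subsidies n H" using H by (simp add: subsidies_def)
      then show "subsidies n H \<noteq> {}" by blast
    qed (use bounds in auto)
    then have "?good = space ?P"
      using bounds 2 by (fastforce simp: is_ERM_def)
    then show ?thesis using \<delta> P.prob_space by (intro bexI[of _ "space ?P"]) auto
  next
    case 3
    obtain A where A: "A \<in> sets ?P" "measure ?P A \<le> \<delta>"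
      and good: "\<And>S \<sigma>h. S \<in> space ?P - A \<Longrightarrow> is_ERM n H m S \<sigma>h \<Longrightarrow>
        exp_loss n D \<sigma>h \<le> (INF \<sigma>\<in>subsidies n H. exp_loss n D \<sigma>) + \<epsilon>"
      by (rule erm_subsidy_guarantee[OF D 3(1) H _ _ \<epsilon> 3(2) \<delta> 3(3) m]) (use valid meas in auto)
    show ?thesis
    proof (intro bexI[of _ "space ?P - A"] conjI)
      show "space ?P - A \<subseteq> ?good" using good by auto
      show "1 - \<delta> \<le> measure ?P (space ?P - A)" using A P.prob_compl[of A] by simp
    qed (use A in auto)
  qed
qed simp

end
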